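(* For any decimal $d\in\mathbb{R}$, the multiplicative $d$-shift $$u(x)\mapsto u(d\cdot_Rx),\quad x\in\mathbb{R},$$ on $X_R$ is computable if and only if $d=a_R/b_R\ge_R0_R$ is a nonnegative fraction such that $a\in\mathbb{N}_0$, $b\in\mathbb{N}$, $a$ and $b$ are coprime, and if $a\ne0$ then $a$ is not divisible by any prime number different from $2$ and $5$.
   Context: $\mathbb{N}=\{1,2,\dots\}$, $\mathbb{N}_0=\{0,1,2,\dots\}$, $D=\{0,1,\dots,9\}$. **Decimals.** A decimal is a formal infinite linear combination $d=(-)\sum_{n\le k}d_n10^n$ with an optional minus sign, $k\in\mathbb{N}_0$ (the order of $d$), $n\in\mathbb{Z}$, $d_n\in D$, such that (i) $d_k=0$ implies $k=0$; (ii) there is no $n\le k$ with $d_m=9$ for all $m\le n$; (iii) $-\sum_{n\le 0}0\cdot10^n$ is not allowed. Digits $d_n$ with $n>k$ are set to $0$. Two decimals are equal iff they have equal signs, orders and digits. $\mathbb{R}$ denotes the set of decimals. $0_R=\sum_{n\le0}0\cdot10^n$, and $1_R$ is the decimal of order $0$ without sign, with digit $1$ at $10^0$ and digits $0$ below. $d\ge_R0_R$ means that $d$ has no minus sign. **Arithmetic of decimals.** Let $\mathbb{Q}_D\subset\mathbb{Q}$ be the subring of fractions with a finite decimal expansion. For a decimal $d=(-)\sum_{n\le k}d_n10^n\in\mathbb{R}$ of order $k$ and $m\in\mathbb{N}$ let $r(d\,|\,m)=\pm\sum_{-m\le n\le k}d_n10^n\in\mathbb{Q}_D$ (with the sign of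 $d$) be the value of the $m$-th truncation of $d$. A sequence $(a_n)\subset\mathbb{Q}_D$ is Cauchy if for every $k\in\mathbb{N}$ there is $n_0\in\mathbb{N}$ with $|a_m-a_n|<1/k$ for all $m,n\ge n_0$. A Cauchy sequence $(a_n)\subset\mathbb{Q}_D$ generates $d$, written $d=G(a_n)$, if for every $k\in\mathbb{N}$ there is $n_0\in\mathbb{N}$ such that $|r(d\,|\,n)-a_n|<1/k$ for all $n\ge n_0$. Every decimal has a generating sequence and every Cauchy sequence in $\mathbb{Q}_D$ generates exactly one decimal. For $d=G(a_n)$, $e=G(b_n)$ one defines $d+_Re:=G(a_n+b_n)$ and $d\cdot_Re:=G(a_nb_n)$ (independent of the choice of generating sequences); with these operations $\mathbb{R}$ is a field with neutral elements $0_R,1_R$. For an integer $a\ge0$, $a_R\in\mathbb{R}$ denotes the decimal expansion of $a$ (generated by the constant sequence $a,a,\dots$), and $a_R/b_R:=a_R\cdot_R(b_R)^{-1}$ for $b\in\mathbb{N}$. **Encodings.** For a nonempty finite alphabet $A$ let $A^{\infty}=A^{\mathbb{N}_0}$ be the set of one-way infinite words over $A$. An encoding is a nonempty subset $X\subset A^\infty$. A unary operation on $X$ is a map $F\colon X\to X$. **Canonical encoding $X_R$.** Let $A=D\cup\{-,\xi\}$, with $\xi$ a separation symbol. A decimal $d=(-)\sum_{n\le k}d_n10^n$ of order $k$ is encoded as the word $u(d)\in A^\infty$ consisting of the minus sign if $d$ has one, then the binary digits of $k$ (least significant digit first; $0$ is written as the single digit $0$), then $\xi$, then the digits $d_k,d_{k-1},d_{k-2},\dots$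 in this order. $X_R=\{u(d)\mid d\in\mathbb{R}\}$. **Unary machines and computability.** A unary machine $M$ (for an encoding $X\subset A^\infty$) is a Turing machine with a finite set of states containing an initial and a terminal state, and with a finite alphabet $A'\supset A\cup\{0,1,\epsilon\}$, where $\epsilon\in A'\setminus A$ is the empty cell symbol. It operates on two bi-infinite tapes $T_1,T_2$, with cells labeled by $\mathbb{Z}$, via corresponding heads; the head on $T_1$ only reads, the head on $T_2$ reads and writes. An input is a pair $(x,m)\in X\times\mathbb{N}_0$: the word $x=x_0x_1\dots$ is stored on $T_1$ with $x_n$ in cell $n$ and $\epsilon$ in every cell $n<0$; $m$ is stored in binary on $T_2$ with the least significant digit in cell $0$ and successive digits in cells $1,2,\dots$, all other cells containing $\epsilon$. The computation starts in the initial state with both heads at cell $0$. In each step, if $M$ is in the terminal state the computation terminates; otherwise, depending only on the current state and the contents of the two scanned cells, $M$ rewrites the scanned cell of $T_2$, moves each head by $-1$, $0$ or $+1$, and passes to a new (possibly the same) state, according to its finite instruction table. $M$ computes $F\colon X\to X$ if for every input $(x,m)$ it terminates with $z_m$ in cell $0$ of $T_2$ and $\epsilon$ in all other cells of $T_2$, where $F(x)=z_0z_1\dots$. A unary operation $F$ is computable if some unary machine computes it. *)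

theory Defs
  imports Complex_Main "HOL-Computational_Algebra.Primes"
begin

section \<open>Decimals\<close>

text \<open>A decimal is a triple: minus sign present, order, digits. The digit function is total
  on the integers, with digits above the order set to 0.\<close>

definition is_decimal :: "bool \<times> nat \<times> (int \<Rightarrow> nat) \<Rightarrow> bool" where
  "is_decimal = (\<lambda>(s, k, f).
      (\<forall>n. f n \<le> 9) \<and>
      (\<forall>n. n > int k \<longrightarrow> f n = 0) \<and>
      (f (int k) = 0 \<longrightarrow> k = 0) \<and>
      \<not> (\<exists>n \<le> int k. \<forall>m \<le> n. f m = 9) \<and>
      \<not> (s \<and> k = 0 \<and> (\<forall>n \<le> 0. f n = 0)))"

typedef decimal = "{x. is_decimal x}"
proof
  show "(False, 0, \<lambda>n. 0) \<in> {x. is_decimal x}"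
    by (auto simp: is_decimal_def)
qed

definition has_minus :: "decimal \<Rightarrow> bool" where
  "has_minus d = fst (Rep_decimal d)"

definition dec_order :: "decimal \<Rightarrow> nat" where
  "dec_order d = fst (snd (Rep_decimal d))"

definition digit :: "decimal \<Rightarrow> int \<Rightarrow> nat" where
  "digit d = snd (snd (Rep_decimal d))"

definition dec_one :: decimal where
  "dec_one = Abs_decimal (False, 0, \<lambda>n. if n = 0 then 1 else 0)"

text \<open>The relation \<open>d \<ge>\<^sub>R 0\<^sub>R\<close>.\<close>

definition dec_nonneg :: "decimal \<Rightarrow> bool" where
  "dec_nonneg d \<longleftrightarrow> \<not> has_minus d"


section \<open>Arithmetic of decimals\<close>

definition finite_decimals :: "rat set" where
  "finite_decimals = {of_int a / 10 ^ k | (a :: int) (k :: nat). True}"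

definition trunc :: "decimal \<Rightarrow> nat \<Rightarrow> rat" where
  "trunc d m = (if has_minus d then - 1 else 1) *
     (\<Sum>n \<in> {- int m .. int (dec_order d)}. of_nat (digit d n) * 10 powi n)"

text \<open>Sequences are indexed by the positive integers; the value at index 0 is ignored.\<close>

definition cauchy_seq :: "(nat \<Rightarrow> rat) \<Rightarrow> bool" where
  "cauchy_seq a \<longleftrightarrow>
     (\<forall>n \<ge> 1. a n \<in> finite_decimals) \<and>
     (\<forall>k :: nat \<ge> 1. \<exists>n0 \<ge> 1. \<forall>m \<ge> n0. \<forall>n \<ge> n0. \<bar>a m - a n\<bar> < 1 / of_nat k)"

definition generates :: "(nat \<Rightarrow> rat) \<Rightarrow> decimal \<Rightarrow> bool" where
  "generates a d \<longleftrightarrow> cauchy_seq a \<and>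
     (\<forall>k :: nat \<ge> 1. \<exists>n0 \<ge> 1. \<forall>n \<ge> n0. \<bar>trunc d n - a n\<bar> < 1 / of_nat k)"

text \<open>The definite descriptions below are justified because every Cauchy sequence generates
  exactly one decimal, the product does not depend on the generating sequences, and nonzero
  decimals have a unique inverse.\<close>

definition dec_mult :: "decimal \<Rightarrow> decimal \<Rightarrow> decimal" where
  "dec_mult d e = (THE f. \<exists>a b. generates a d \<and> generates b e \<and> generates (\<lambda>n. a n * b n) f)"

definition dec_inverse :: "decimal \<Rightarrow> decimal" where
  "dec_inverse d = (THE e. dec_mult d e = dec_one)"

definition dec_of_nat :: "nat \<Rightarrow> decimal" where
  "dec_of_nat a = (THE d. generates (\<lambda>n. of_nat a) d)"

definition dec_frac :: "nat \<Rightarrow> nat \<Rightarrow> decimal" where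
  "dec_frac a b = dec_mult (dec_of_nat a) (dec_inverse (dec_of_nat b))"


section \<open>Encodings\<close>

text \<open>A universe of symbols from which the finite alphabets are taken. \<open>Dig 0\<close> and \<open>Dig 1\<close>
  also serve as the bits 0 and 1, \<open>Sep\<close> is the separation symbol, \<open>Blank\<close> is the empty cell
  symbol, and the symbols \<open>Aux i\<close> are an unlimited supply of further machine symbols.\<close>

datatype symbol = Dig nat | Minus | Sep | Blank | Aux nat

type_synonym word = "nat \<Rightarrow> symbol"

definition encoding :: "symbol set \<Rightarrow> word set \<Rightarrow> bool" where
  "encoding A X \<longleftrightarrow> finite A \<and> A \<noteq> {} \<and> Blank \<notin> A \<and> X \<noteq> {} \<and> (\<forall>x \<in> X. \<forall>n. x n \<in> A)"

text \<open>Binary digits, least significant first; the number 0 has the single digit 0.\<close>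

fun bits :: "nat \<Rightarrow> symbol list" where
  "bits n = (if n < 2 then [Dig n] else Dig (n mod 2) # bits (n div 2))"

declare bits.simps [simp del]

definition A_R :: "symbol set" where
  "A_R = Dig ` {0..9} \<union> {Minus, Sep}"

definition code_prefix :: "decimal \<Rightarrow> symbol list" where
  "code_prefix d = (if has_minus d then [Minus] else []) @ bits (dec_order d) @ [Sep]"

definition u :: "decimal \<Rightarrow> word" where
  "u d n = (if n < length (code_prefix d) then code_prefix d ! n
            else Dig (digit d (int (dec_order d) - int (n - length (code_prefix d)))))"

definition X_R :: "word set" where
  "X_R = range u"


section \<open>Unary machines\<close>

text \<open>States are natural numbers, which is no restriction as there are finitely many. The
  instruction table maps a state and the two scanned symbols to the new state, the symbol
  written on the second tape and the moves of the two heads. Its values outside the finite set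
  of states and the finite machine alphabet are irrelevant.\<close>

record machine =
  m_states :: "nat set"
  m_init :: nat
  m_term :: nat
  m_alphabet :: "symbol set"
  m_table :: "nat \<Rightarrow> symbol \<Rightarrow> symbol \<Rightarrow> nat \<times> symbol \<times> int \<times> int"

definition unary_machine :: "symbol set \<Rightarrow> machine \<Rightarrow> bool" where
  "unary_machine A M \<longleftrightarrow>
     finite (m_states M) \<and> m_init M \<in> m_states M \<and> m_term M \<in> m_states M \<and>
     finite (m_alphabet M) \<and> A \<union> {Dig 0, Dig 1, Blank} \<subseteq> m_alphabet M \<and>
     (\<forall>q \<in> m_states M. \<forall>s \<in> m_alphabet M. \<forall>t \<in> m_alphabet M.
        m_table M q s t \<in> m_states M \<times> m_alphabet M \<times> {-1, 0, 1} \<times> {-1, 0, 1})"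

text \<open>A configuration consists of the state, the positions of the two heads, and the content of
  the second tape. The first tape never changes.\<close>

type_synonym config = "nat \<times> int \<times> int \<times> (int \<Rightarrow> symbol)"

definition tape1 :: "word \<Rightarrow> int \<Rightarrow> symbol" where
  "tape1 x i = (if i < 0 then Blank else x (nat i))"

definition tape2 :: "nat \<Rightarrow> int \<Rightarrow> symbol" where
  "tape2 m i = (if 0 \<le> i \<and> i < int (length (bits m)) then bits m ! nat i else Blank)"

definition init_config :: "machine \<Rightarrow> nat \<Rightarrow> config" where
  "init_config M m = (m_init M, 0, 0, tape2 m)"

definition step :: "machine \<Rightarrow> word \<Rightarrow> config \<Rightarrow> config" where
  "step M x = (\<lambda>(q, h1, h2, T).
     if q = m_term M then (q, h1, h2, T)
     else (case m_table M q (tape1 x h1) (T h2) of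
             (q', s, v1, v2) \<Rightarrow> (q', h1 + v1, h2 + v2, T(h2 := s))))"

definition terminates_with :: "machine \<Rightarrow> word \<Rightarrow> nat \<Rightarrow> (int \<Rightarrow> symbol) \<Rightarrow> bool" where
  "terminates_with M x m T \<longleftrightarrow>
     (\<exists>t h1 h2. (step M x ^^ t) (init_config M m) = (m_term M, h1, h2, T))"

definition computes :: "machine \<Rightarrow> word set \<Rightarrow> (word \<Rightarrow> word) \<Rightarrow> bool" where
  "computes M X F \<longleftrightarrow>
     (\<forall>x \<in> X. \<forall>m. terminates_with M x m (\<lambda>i. if i = 0 then F x m else Blank))"

text \<open>Only the restriction of \<open>F\<close> to \<open>X\<close> matters.\<close>

definition computable :: "symbol set \<Rightarrow> word set \<Rightarrow> (word \<Rightarrow> word) \<Rightarrow> bool" where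
  "computable A X F \<longleftrightarrow>
     encoding A X \<and> F ` X \<subseteq> X \<and> (\<exists>M. unary_machine A M \<and> computes M X F)"

text \<open>The map \<open>u x \<mapsto> u (d \<cdot>\<^sub>R x)\<close>, well defined on \<open>X_R\<close> because \<open>u\<close> is injective.\<close>

definition mult_shift :: "decimal \<Rightarrow> word \<Rightarrow> word" where
  "mult_shift d w = u (dec_mult d (the_inv u w))"

end

theory Submission
  imports Defs "HOL-Library.Countable"
begin

text \<open>
  Reading off the real value of a decimal is a bijection under which decimal multiplication becomes
  real multiplication, so everything below is stated for real numbers.

  The condition is necessary because a halting computation reads only finitely many cells of its
  input, which makes every output symbol locally constant in the input word
  (\<open>computes_continuous\<close>). For negative \<open>d\<close> this fails at \<open>0\<close>: the word of \<open>d \<cdot> 0\<close> has no minus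
  sign, but the words of \<open>d \<cdot> 1 / 10\<^sup>i\<close> do, while \<open>0\<close> and \<open>1 / 10\<^sup>i\<close> have long common prefixes. For
  positive \<open>d\<close> it fails at \<open>1 / d\<close> whenever this number has an infinite expansion: its truncations
  are then strictly smaller and have products with \<open>d\<close> just below \<open>1\<close>, so that the unit digit of the
  result is \<open>0\<close> instead of \<open>1\<close>. Hence \<open>1 / d = N / 10\<^sup>j\<close>, so \<open>d\<close> is \<open>0\<close> or \<open>10\<^sup>j / N\<close>, and the
  reduced numerator divides \<open>10\<^sup>j\<close>.

  Conversely, if only \<open>2\<close> and \<open>5\<close> divide the numerator \<open>a \<noteq> 0\<close>, then \<open>a\<close> divides some \<open>10\<^sup>n\<close> and
  \<open>d = 10\<^sup>n / B\<close> with \<open>B\<close> a positive integer. Multiplication by \<open>10\<^sup>n\<close> shifts digits, and division by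
  \<open>B\<close> is long division from left to right, which needs only the current remainder as memory; no
  carry ever comes from the right. What remains is to write down the order of the quotient. It is
  \<open>k + n - s\<close>, where \<open>k\<close> is the order of the input and \<open>s\<close>, the number of leading quotient digits to
  suppress, is bounded; it depends only on \<open>min B k\<close> and a bounded number of leading digits. A
  finite-state device that may move back and forth on the input can therefore compute \<open>s\<close> first,
  return to the start, add \<open>n - s\<close> to the binary order bit by bit, and then divide
  (\<open>divider_run\<close>).

  Such a two-way finite-state transducer produces the output symbols one after another. The position
  \<open>m\<close> written on the second tape turns it into a unary machine: each produced symbol decrements the
  binary counter \<open>m\<close>, and the symbol that finds the counter at zero is the answer
  (\<open>transducer_computable\<close>).
\<close>

section \<open>Decimals as real numbers\<close>

lemma is_decimal_Rep: "is_decimal (has_minus d, dec_order d, digit d)"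
  using Rep_decimal[of d] by (simp add: has_minus_def dec_order_def digit_def)

lemma digit_le_9: "digit d p \<le> 9"
  and digit_above_order: "p > int (dec_order d) \<Longrightarrow> digit d p = 0"
  and leading_digit: "digit d (int (dec_order d)) = 0 \<Longrightarrow> dec_order d = 0"
  and no_trailing_nines: "p \<le> int (dec_order d) \<Longrightarrow> \<exists>q\<le>p. digit d q \<noteq> 9"
  and minus_nonzero: "has_minus d \<Longrightarrow> dec_order d = 0 \<Longrightarrow> \<exists>p\<le>0. digit d p \<noteq> 0"
  using is_decimal_Rep[of d] unfolding is_decimal_def by auto

lemma decimal_eqI:
  assumes "has_minus d = has_minus e" "dec_order d = dec_order e" "\<And>p. digit d p = digit e p"
  shows "d = e"
proof -
  have "digit d = digit e" using assms(3) by auto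
  then have "Rep_decimal d = Rep_decimal e"
    using assms(1,2) by (simp add: has_minus_def dec_order_def digit_def prod_eq_iff)
  then show ?thesis by (simp add: Rep_decimal_inject)
qed

text \<open>Digits are counted from the top, as a machine reads them, and taken together as one natural
number; all digit arithmetic below then takes place in the natural numbers.\<close>

fun leading :: "decimal \<Rightarrow> nat \<Rightarrow> nat" where
  "leading d 0 = 0"
| "leading d (Suc i) = 10 * leading d i + digit d (int (dec_order d) - int i)"

definition mag :: "decimal \<Rightarrow> real" where
  "mag d = lim (\<lambda>i. real (leading d i) / 10 ^ i) * 10 ^ (dec_order d + 1)"

text \<open>The strict upper bound is where the ban on trailing nines enters: the upper approximations
\<open>(leading d i + 1) / 10 ^ i\<close> decrease, and each is followed by a strictly smaller one because some
later digit is not \<open>9\<close>. The limit therefore stays strictly below all of them.\<close>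

lemma leading_bounds:
  "real (leading d i) \<le> mag d * 10 ^ i / 10 ^ (dec_order d + 1)"
  "mag d * 10 ^ i / 10 ^ (dec_order d + 1) < real (leading d i) + 1"
proof -
  define l where "l = (\<lambda>i. real (leading d i) / 10 ^ i)"
  define h where "h = (\<lambda>i. (real (leading d i) + 1) / 10 ^ i)"
  have "incseq l"
    by (rule incseq_SucI) (simp add: l_def field_simps)
  have "decseq h"
  proof (rule decseq_SucI)
    fix i show "h (Suc i) \<le> h i"
      using digit_le_9[of d "int (dec_order d) - int i"] by (simp add: h_def field_simps)
  qed
  have lh: "l i \<le> h j" for i j
  proof -
    have "l i \<le> l (max i j)" using \<open>incseq l\<close> by (auto simp: incseq_def)
    also have "\<dots> \<le> h (max i j)" by (simp add: l_def h_def field_simps)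
    also have "\<dots> \<le> h j" using \<open>decseq h\<close> by (auto simp: decseq_def)
    finally show ?thesis .
  qed
  obtain L where L: "l \<longlonglongrightarrow> L" "\<And>i. l i \<le> L"
    using incseq_convergent[OF \<open>incseq l\<close>, of "h 0"] lh by blast
  have Lh: "L \<le> h j" for j
    using L(1) lh by (intro LIMSEQ_le_const2) auto
  have Lstrict: "L < h j" for j
  proof -
    obtain q where q: "q \<le> int (dec_order d) - int j" "digit d q \<noteq> 9"
      using no_trailing_nines[of "int (dec_order d) - int j" d] by auto
    define i where "i = nat (int (dec_order d) - q)"
    have i: "q = int (dec_order d) - int i" "j \<le> i" using q by (auto simp: i_def)
    have "digit d q \<le> 8" using q(2) digit_le_9[of d q] by linarith
    then have "h (Suc i) < h i" using i by (simp add: h_def field_simps)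
    also have "h i \<le> h j" using \<open>decseq h\<close> i by (auto simp: decseq_def)
    finally show ?thesis using Lh[of "Suc i"] by linarith
  qed
  have "lim l = L" using L(1) by (rule limI)
  then have mag: "mag d = L * 10 ^ (dec_order d + 1)" by (simp add: mag_def l_def)
  show "real (leading d i) \<le> mag d * 10 ^ i / 10 ^ (dec_order d + 1)"
    using L(2)[of i] by (simp add: mag l_def field_simps)
  show "mag d * 10 ^ i / 10 ^ (dec_order d + 1) < real (leading d i) + 1"
    using Lstrict[of i] by (simp add: mag h_def field_simps)
qed

lemma leading_eq_floor: "int (leading d i) = \<lfloor>mag d * 10 ^ i / 10 ^ (dec_order d + 1)\<rfloor>"
  using leading_bounds[where d=d and i=i] by (intro floor_unique[symmetric]) auto

text \<open>Equal integer parts at every scale force equality, since both numbers lie within \<open>10 ^ (k + 1 - i)\<close>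
of each other for every \<open>i\<close>.\<close>

lemma mag_eqI:
  assumes "\<And>i. int (leading d i) = \<lfloor>v * 10 ^ i / 10 ^ (dec_order d + 1)\<rfloor>"
  shows "mag d = v"
proof -
  define K :: real where "K = 10 ^ (dec_order d + 1)"
  have "K > 0" by (simp add: K_def)
  have close: "\<bar>mag d - v\<bar> / K \<le> (1/10) ^ i" for i
  proof -
    have "\<lfloor>mag d * 10 ^ i / K\<rfloor> = \<lfloor>v * 10 ^ i / K\<rfloor>"
      using assms[of i] leading_eq_floor[of d i] by (simp add: K_def)
    then have "\<bar>mag d * 10 ^ i / K - v * 10 ^ i / K\<bar> \<le> 1" by linarith
    moreover have "mag d * 10 ^ i / K - v * 10 ^ i / K = (mag d - v) / K * 10 ^ i"
      by (simp add: algebra_simps diff_divide_distrib)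
    ultimately have "\<bar>mag d - v\<bar> / K * 10 ^ i \<le> 1"
      using \<open>K > 0\<close> by (simp add: abs_mult)
    then show ?thesis by (simp add: field_simps)
  qed
  have "(\<lambda>i. (1/10::real) ^ i) \<longlonglongrightarrow> 0" by (rule LIMSEQ_power_zero) simp
  then have "\<bar>mag d - v\<bar> / K \<le> 0" by (rule LIMSEQ_le_const) (use close in auto)
  then show ?thesis using \<open>K > 0\<close> by (simp add: divide_le_0_iff)
qed

lemma mag_nonneg: "0 \<le> mag d"
proof -
  have "0 \<le> mag d / 10 ^ (dec_order d + 1)" using leading_bounds(1)[of d 0] by simp
  moreover have "(0::real) < 10 ^ (dec_order d + 1)" by simp
  ultimately show ?thesis by (metis divide_less_0_iff not_less)
qed

lemma mag_less: "mag d < 10 ^ (dec_order d + 1)"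
  using leading_bounds(2)[of d 0] by simp

lemma mag_ge: "dec_order d = 0 \<or> 10 ^ dec_order d \<le> mag d"
proof (cases "dec_order d = 0")
  case False
  from False have nz: "digit d (int (dec_order d)) \<noteq> 0" using leading_digit[of d] by argo
  have "leading d (Suc 0) = digit d (int (dec_order d))" by simp
  then have "1 \<le> real (leading d (Suc 0))" using nz by linarith
  also have "\<dots> \<le> mag d / 10 ^ dec_order d" using leading_bounds(1)[of d "Suc 0"] by (simp del: leading.simps)
  finally have "10 ^ dec_order d \<le> mag d" by (simp add: field_simps)
  then show ?thesis ..
qed simp

text \<open>Together with \<open>mag_less\<close> and \<open>mag_ge\<close>, which determine the order, this recovers a decimal from its
absolute value and sign.\<close>

lemma digit_eq_floor: "digit d p = nat \<lfloor>mag d / 10 powi p\<rfloor> mod 10"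
proof (cases "p \<le> int (dec_order d)")
  case True
  define i where "i = nat (int (dec_order d) - p)"
  have i: "p = int (dec_order d) - int i" using True by (simp add: i_def)
  have "(10::real) powi p = 10 ^ dec_order d / 10 ^ i"
    by (simp add: i power_int_diff)
  then have "mag d / 10 powi p = mag d * 10 ^ Suc i / 10 ^ (dec_order d + 1)"
    by (simp add: field_simps)
  then have "nat \<lfloor>mag d / 10 powi p\<rfloor> = leading d (Suc i)"
    using leading_eq_floor[of d "Suc i"] by (simp del: leading.simps power_Suc)
  then show ?thesis using digit_le_9[of d p] by (simp add: i[symmetric])
next
  case False
  have "10 ^ (dec_order d + 1) = (10::real) powi (int (dec_order d + 1))"
    by (simp only: power_int_of_nat)
  also have "\<dots> \<le> 10 powi p" using False by (intro power_int_increasing) auto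
  finally have "mag d < 10 powi p" using mag_less[of d] by linarith
  then have "\<lfloor>mag d / 10 powi p\<rfloor> = 0"
    using mag_nonneg[of d] by (intro floor_unique) (auto simp: field_simps)
  then show ?thesis using False digit_above_order by simp
qed

lemma order_unique:
  fixes v :: real and k l :: nat
  assumes "v < 10 ^ (k + 1)" "k = 0 \<or> 10 ^ k \<le> v" "v < 10 ^ (l + 1)" "l = 0 \<or> 10 ^ l \<le> v"
  shows "k = l"
proof -
  have "k \<le> l" if "v < 10 ^ (l + 1)" "k = 0 \<or> 10 ^ k \<le> v" for k l
  proof (rule ccontr)
    assume "\<not> k \<le> l"
    then have "(10::real) ^ (l + 1) \<le> 10 ^ k" by (intro power_increasing) auto
    then show False using that \<open>\<not> k \<le> l\<close> by auto
  qed
  then show ?thesis using assms by (intro antisym) auto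
qed

lemma order_eqI:
  assumes "mag d < 10 ^ (k + 1)" "k = 0 \<or> 10 ^ k \<le> mag d"
  shows "dec_order d = k"
  using order_unique[OF mag_less mag_ge assms] .

definition rval :: "decimal \<Rightarrow> real" where
  "rval d = (if has_minus d then - mag d else mag d)"

lemma abs_rval: "\<bar>rval d\<bar> = mag d"
  using mag_nonneg[of d] by (simp add: rval_def)

lemma has_minus_iff: "has_minus d \<longleftrightarrow> rval d < 0"
proof
  assume m: "has_minus d"
  have "mag d \<noteq> 0"
  proof
    assume 0: "mag d = 0"
    have "(0::real) < 10 ^ dec_order d" by simp
    then have "dec_order d = 0" using mag_ge[of d] 0 by linarith
    then obtain p where "digit d p \<noteq> 0" using minus_nonzero[OF m] by blast
    then show False using digit_eq_floor[of d p] 0 by simp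
  qed
  then have "0 < mag d" using mag_nonneg[of d] by linarith
  then show "rval d < 0" using m by (simp add: rval_def)
next
  assume "rval d < 0"
  then show "has_minus d" using mag_nonneg[of d] unfolding rval_def by (cases "has_minus d") auto
qed

lemma rval_inject: "rval d = rval e \<longleftrightarrow> d = e"
proof
  assume eq: "rval d = rval e"
  then have m: "mag d = mag e" using abs_rval[of d] abs_rval[of e] eq by simp
  show "d = e"
  proof (rule decimal_eqI)
    show "has_minus d = has_minus e" by (simp add: has_minus_iff eq)
    show "dec_order d = dec_order e" using order_unique[OF mag_less mag_ge, of d "dec_order e"] mag_less[of e] mag_ge[of e] unfolding m by blast
    show "digit d p = digit e p" for p unfolding digit_eq_floor m ..
  qed
qed simp

lemma floor_times_ten: "\<lfloor>10 * z\<rfloor> div 10 = \<lfloor>z :: real\<rfloor>"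
proof -
  have "\<lfloor>10 * z\<rfloor> div 10 = \<lfloor>(10 * z) / of_int 10\<rfloor>"
    by (rule floor_divide_real_eq_div[symmetric]) simp
  then show ?thesis by simp
qed

text \<open>The digits of \<open>y\<close> are taken from the integer parts \<open>g i\<close> of \<open>\<bar>y\<bar>\<close> at all scales. They cannot end in
nines: if they did from place \<open>j\<close> on, then \<open>g (j + i) + 1 = 10 ^ i * (g j + 1)\<close> for all \<open>i\<close>, which
pushes the scaled value up to \<open>g j + 1\<close>, above its own integer part by a full unit.\<close>

lemma rval_surj: "\<exists>d. rval d = y"
proof -
  define v where "v = \<bar>y\<bar>"
  have "v \<ge> 0" by (simp add: v_def)
  obtain N where "v < 10 ^ N" using real_arch_pow[of 10 v] by auto
  also have "(10::real) ^ N \<le> 10 ^ (N + 1)" by simp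
  finally have ex: "\<exists>k. v < 10 ^ (k + 1)" by blast
  define k where "k = (LEAST k. v < 10 ^ (k + 1))"
  have k1: "v < 10 ^ (k + 1)" unfolding k_def by (rule LeastI_ex[OF ex])
  have k2: "k = 0 \<or> 10 ^ k \<le> v"
  proof (cases k)
    case (Suc j)
    then have "\<not> v < 10 ^ (j + 1)"
      using not_less_Least[of j "\<lambda>k. v < 10 ^ (k + 1)"] by (simp add: k_def)
    then show ?thesis using Suc by simp
  qed simp
  define g where "g = (\<lambda>i. nat \<lfloor>v * 10 ^ i / 10 ^ (k + 1)\<rfloor>)"
  have intg: "int (g i) = \<lfloor>v * 10 ^ i / 10 ^ (k + 1)\<rfloor>" for i
    using \<open>v \<ge> 0\<close> by (simp add: g_def)
  have g0: "g 0 = 0" using k1 \<open>v \<ge> 0\<close>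
    by (simp add: g_def floor_eq_iff)
  have gdiv: "g (Suc i) div 10 = g i" for i
  proof -
    have "int (g (Suc i)) div 10 = int (g i)"
      using floor_times_ten[of "v * 10 ^ i / 10 ^ (k + 1)"] unfolding intg
      by (simp add: mult.left_commute)
    then show ?thesis by linarith
  qed
  define f where "f = (\<lambda>p::int. if p > int k then 0 else g (Suc (nat (int k - p))) mod 10)"
  have dec: "is_decimal (y < 0, k, f)"
  proof -
    have "\<exists>m\<le>n. f m \<noteq> 9" if "n \<le> int k" for n
    proof (rule ccontr)
      assume "\<not> (\<exists>m\<le>n. f m \<noteq> 9)"
      then have nine: "f m = 9" if "m \<le> n" for m using that by auto
      define j where "j = nat (int k - n)"
      have g9: "g (Suc i) = 10 * g i + 9" if "j \<le> i" for i
      proof -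
        have "f (int k - int i) = 9" using that \<open>n \<le> int k\<close> by (intro nine) (auto simp: j_def)
        then have "g (Suc i) mod 10 = 9" by (simp add: f_def)
        then show ?thesis using gdiv[of i] by presburger
      qed
      \<comment> \<open>Rounding the trailing nines up gives a constant value at all finer scales.\<close>
      have top: "g (j + i) + 1 = 10 ^ i * (g j + 1)" for i
        by (induction i) (auto simp: g9)
      define w where "w = v * 10 ^ j / 10 ^ (k + 1)"
      have "w < real (g j) + 1" using intg[of j] unfolding w_def by linarith
      moreover have "real (g j) + 1 - w \<le> (1/10) ^ i" for i
      proof -
        have "real (g (j + i)) \<le> w * 10 ^ i"
        proof -
          have "w * 10 ^ i = v * 10 ^ (j + i) / 10 ^ (k + 1)" by (simp add: w_def power_add)
          then show ?thesis using intg[of "j + i"] by linarith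
        qed
        moreover have "real (g (j + i)) + 1 = 10 ^ i * (real (g j) + 1)"
          using arg_cong[OF top[of i], of real] by (simp add: algebra_simps)
        ultimately have "10 ^ i * (real (g j) + 1) \<le> w * 10 ^ i + 1" by linarith
        then show ?thesis by (simp add: field_simps)
      qed
      moreover have "(\<lambda>i. (1/10::real) ^ i) \<longlonglongrightarrow> 0" by (rule LIMSEQ_power_zero) simp
      ultimately have "real (g j) + 1 - w \<le> 0"
        by (intro LIMSEQ_le_const[of "\<lambda>i. (1/10::real) ^ i"]) auto
      with \<open>w < real (g j) + 1\<close> show False by simp
    qed
    moreover have lead: "f (int k) = 0 \<Longrightarrow> k = 0"
    proof (rule ccontr)
      assume a: "f (int k) = 0" "k \<noteq> 0"
      then have "g 1 mod 10 = 0" by (simp add: f_def)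
      then have "g 1 = 0" using gdiv[of 0] g0 by simp
      then have "\<lfloor>v / 10 ^ k\<rfloor> = 0" using intg[of 1] by simp
      then have "v / 10 ^ k < 1" by linarith
      then show False using k2 a by (simp add: field_simps)
    qed
    moreover have "\<not> (y < 0 \<and> k = 0 \<and> (\<forall>n\<le>0. f n = 0))"
    proof
      assume a: "y < 0 \<and> k = 0 \<and> (\<forall>n\<le>0. f n = 0)"
      have "g i = 0" for i
      proof (induction i)
        case (Suc i)
        have "f (- int i) = 0" using a by simp
        then have "g (Suc i) mod 10 = 0" using a by (simp add: f_def)
        then show ?case using gdiv[of i] Suc by presburger
      qed (rule g0)
      then have "v * 10 ^ i / 10 < 1" for i using intg[of i] a by (simp add: floor_eq_iff)
      moreover obtain i where "1 / (v / 10) < 10 ^ i" using real_arch_pow[of 10 "1 / (v / 10)"] by auto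
      moreover have "v > 0" using a by (simp add: v_def)
      ultimately show False by (simp add: field_simps) (meson not_less_iff_gr_or_eq)
    qed
    moreover have "\<forall>n. f n \<le> 9" "\<forall>n>int k. f n = 0" by (auto simp: f_def)
    ultimately show ?thesis unfolding is_decimal_def split_conv by blast
  qed
  define d where "d = Abs_decimal (y < 0, k, f)"
  have "Rep_decimal d = (y < 0, k, f)" using dec by (simp add: d_def Abs_decimal_inverse)
  then have d: "has_minus d = (y < 0)" "dec_order d = k" "digit d = f"
    by (simp_all add: has_minus_def dec_order_def digit_def)
  have "leading d i = g i" for i
  proof (induction i)
    case (Suc i)
    have "g (Suc i) = 10 * g i + g (Suc i) mod 10" using gdiv[of i] by presburger
    then show ?case using Suc by (simp add: d f_def)
  qed (simp add: g0)
  then have "mag d = v" by (intro mag_eqI) (simp add: intg d)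
  then have "rval d = y" by (simp add: rval_def d v_def)
  then show ?thesis ..
qed

definition dec_of_real :: "real \<Rightarrow> decimal" where
  "dec_of_real y = (SOME d. rval d = y)"

lemma rval_dec_of_real [simp]: "rval (dec_of_real y) = y"
  unfolding dec_of_real_def by (rule someI_ex[OF rval_surj])

lemma trunc_eq:
  "trunc d m = (if has_minus d then -1 else 1) * (of_nat (leading d (dec_order d + m + 1)) / 10 ^ m)"
proof -
  have S: "(\<Sum>n \<in> {int (dec_order d) + 1 - int i .. int (dec_order d)}. of_nat (digit d n) * (10::rat) powi n)
     = of_nat (leading d i) * 10 powi (int (dec_order d) + 1 - int i)" for i
  proof (induction i)
    case (Suc i)
    have "{int (dec_order d) + 1 - int (Suc i) .. int (dec_order d)}
        = insert (int (dec_order d) - int i) {int (dec_order d) + 1 - int i .. int (dec_order d)}" by auto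
    moreover have "(10::rat) powi (int (dec_order d) + 1 - int i) = 10 * 10 powi (int (dec_order d) - int i)"
      by (simp add: power_int_diff power_int_add)
    ultimately show ?case using Suc by (simp add: algebra_simps)
  qed simp
  have "(10::rat) powi (- int m) = 1 / 10 ^ m" by (simp add: power_int_minus divide_inverse)
  moreover have "int (dec_order d) + 1 - int (dec_order d + m + 1) = - int m" by simp
  ultimately have "(\<Sum>n \<in> {- int m .. int (dec_order d)}. of_nat (digit d n) * (10::rat) powi n)
     = of_nat (leading d (dec_order d + m + 1)) / 10 ^ m"
    using S[of "dec_order d + m + 1"] by (simp del: leading.simps)
  then show ?thesis unfolding trunc_def by simp
qed

lemma real_trunc:
  "real_of_rat (trunc d m) = (if has_minus d then -1 else 1) * (real (leading d (dec_order d + m + 1)) / 10 ^ m)"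
  unfolding trunc_eq by (simp add: of_rat_mult of_rat_divide of_rat_power of_rat_minus del: leading.simps)

lemma trunc_finite_decimal: "trunc d m \<in> finite_decimals"
proof -
  have "trunc d m = of_int ((if has_minus d then -1 else 1) * int (leading d (dec_order d + m + 1))) / 10 ^ m"
    unfolding trunc_eq by (simp del: leading.simps)
  then show ?thesis unfolding finite_decimals_def by blast
qed

lemma trunc_tendsto: "(\<lambda>m. real_of_rat (trunc d m)) \<longlonglongrightarrow> rval d"
proof (rule LIMSEQ_I)
  fix r :: real assume "r > 0"
  have bd: "\<bar>real_of_rat (trunc d m) - rval d\<bar> \<le> (1/10) ^ m" for m
  proof -
    define P where "P = real (leading d (dec_order d + m + 1))"
    have "mag d * 10 ^ (dec_order d + m + 1) / 10 ^ (dec_order d + 1) = mag d * 10 ^ m"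
      by (simp add: power_add)
    then have "P \<le> mag d * 10 ^ m" "mag d * 10 ^ m < P + 1"
      using leading_bounds[where d=d and i="dec_order d + m + 1"] by (simp_all add: P_def)
    then have "P / 10 ^ m \<le> mag d" "mag d \<le> (P + 1) / 10 ^ m"
      by (simp_all add: pos_divide_le_eq pos_le_divide_eq)
    then have "\<bar>P / 10 ^ m - mag d\<bar> \<le> (1/10) ^ m"
      by (simp add: add_divide_distrib power_one_over abs_le_iff)
    then show ?thesis
      unfolding real_trunc rval_def P_def by (auto simp: abs_minus_commute simp del: leading.simps)
  qed
  obtain N where N: "(1/10::real) ^ N < r" using real_arch_pow_inv[of r "1/10"] \<open>r > 0\<close> by auto
  show "\<exists>N. \<forall>n\<ge>N. norm (real_of_rat (trunc d n) - rval d) < r"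
  proof (intro exI allI impI)
    fix n assume "N \<le> n"
    then have "(1/10::real) ^ n \<le> (1/10) ^ N" by (intro power_decreasing) auto
    then show "norm (real_of_rat (trunc d n) - rval d) < r" using bd[of n] N unfolding real_norm_def by linarith
  qed
qed

text \<open>Generating a decimal means converging to its value, because the truncations of a decimal do.\<close>

lemma generates_iff:
  "generates a d \<longleftrightarrow> (\<forall>n\<ge>1. a n \<in> finite_decimals) \<and> (\<lambda>n. real_of_rat (a n)) \<longlonglongrightarrow> rval d"
  (is "_ \<longleftrightarrow> ?F \<and> ?L")
proof
  assume g: "generates a d"
  have "(\<lambda>n. real_of_rat (trunc d n) - real_of_rat (a n)) \<longlonglongrightarrow> 0"
  proof (rule LIMSEQ_I)
    fix r :: real assume "r > 0"
    then obtain k where k: "1 / real (Suc k) < r" by (metis nat_approx_posE)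
    obtain n0 where "\<forall>n\<ge>n0. \<bar>trunc d n - a n\<bar> < 1 / of_nat (Suc k)"
      using g unfolding generates_def by (metis le_add1 plus_1_eq_Suc)
    then have "\<forall>n\<ge>n0. real_of_rat \<bar>trunc d n - a n\<bar> < real_of_rat (1 / of_nat (Suc k))"
      by (simp only: of_rat_less) 
    then have "\<forall>n\<ge>n0. \<bar>real_of_rat (trunc d n) - real_of_rat (a n)\<bar> < 1 / real (Suc k)"
      by (simp only: of_rat_divide of_rat_1 of_rat_of_nat_eq flip: of_rat_diff abs_of_rat) 
    then show "\<exists>no. \<forall>n\<ge>no. norm (real_of_rat (trunc d n) - real_of_rat (a n) - 0) < r"
      using k by (metis diff_zero order.strict_trans real_norm_def)
  qed
  from tendsto_diff[OF trunc_tendsto[of d] this] have ?L by simp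
  moreover have ?F using g by (simp add: generates_def cauchy_seq_def)
  ultimately show "?F \<and> ?L" by blast
next
  assume fl: "?F \<and> ?L"
  have close: "\<exists>n0\<ge>1. \<forall>n\<ge>n0. \<bar>real_of_rat (a n) - rval d\<bar> < e \<and> \<bar>real_of_rat (trunc d n) - rval d\<bar> < e"
    if e: "e > 0" for e
  proof -
    obtain n1 n2 where "\<forall>n\<ge>n1. \<bar>real_of_rat (a n) - rval d\<bar> < e"
      "\<forall>n\<ge>n2. \<bar>real_of_rat (trunc d n) - rval d\<bar> < e"
      using LIMSEQ_D[OF conjunct2[OF fl] e] LIMSEQ_D[OF trunc_tendsto[of d] e] by auto
    then show ?thesis by (intro exI[of _ "max 1 (max n1 n2)"]) auto
  qed
  have rat: "\<bar>p - q\<bar> < 1 / of_nat k"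
    if "\<bar>real_of_rat p - x\<bar> < 1 / (2 * real k)" "\<bar>real_of_rat q - x\<bar> < 1 / (2 * real k)" for p q x k
  proof -
    have "\<bar>real_of_rat p - real_of_rat q\<bar> < 1 / (2 * real k) + 1 / (2 * real k)" using that by linarith
    then have "real_of_rat \<bar>p - q\<bar> < real_of_rat (1 / of_nat k)"
      by (simp add: of_rat_divide flip: of_rat_diff)
    then show ?thesis by (simp only: of_rat_less)
  qed
  show "generates a d"
    unfolding generates_def cauchy_seq_def
  proof (intro conjI allI impI)
    fix k :: nat assume "1 \<le> k"
    then have "1 / (2 * real k) > 0" by simp
    from close[OF this] obtain n0 where n0: "n0 \<ge> 1" "\<forall>n\<ge>n0. \<bar>real_of_rat (a n) - rval d\<bar> < 1 / (2 * real k)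
      \<and> \<bar>real_of_rat (trunc d n) - rval d\<bar> < 1 / (2 * real k)" by blast
    show "\<exists>n0\<ge>1. \<forall>m\<ge>n0. \<forall>n\<ge>n0. \<bar>a m - a n\<bar> < 1 / of_nat k"
      using n0 rat by blast
    show "\<exists>n0\<ge>1. \<forall>n\<ge>n0. \<bar>trunc d n - a n\<bar> < 1 / of_nat k"
      using n0 rat by blast
  qed (use fl in auto)
qed

lemma finite_decimals_mult: "p \<in> finite_decimals \<Longrightarrow> q \<in> finite_decimals \<Longrightarrow> p * q \<in> finite_decimals"
proof -
  assume "p \<in> finite_decimals" "q \<in> finite_decimals"
  then obtain a k b l where "p = of_int a / 10 ^ k" "q = of_int b / 10 ^ l"
    by (auto simp: finite_decimals_def)
  then have "p * q = of_int (a * b) / 10 ^ (k + l)" by (simp add: power_add)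
  then show ?thesis unfolding finite_decimals_def by blast
qed

text \<open>The truncations of the two factors are generating sequences, so the definite description is
satisfied; it is unique because limits are.\<close>

lemma dec_mult_eq: "dec_mult d e = dec_of_real (rval d * rval e)"
  unfolding dec_mult_def
proof (rule the_equality)
  have "generates (trunc d) d" "generates (trunc e) e"
    by (simp_all add: generates_iff trunc_finite_decimal trunc_tendsto)
  moreover have "generates (\<lambda>n. trunc d n * trunc e n) (dec_of_real (rval d * rval e))"
    by (simp add: generates_iff trunc_finite_decimal finite_decimals_mult of_rat_mult tendsto_mult trunc_tendsto)
  ultimately show "\<exists>a b. generates a d \<and> generates b e \<and> generates (\<lambda>n. a n * b n) (dec_of_real (rval d * rval e))"
    by blast
next
  fix f assume "\<exists>a b. generates a d \<and> generates b e \<and> generates (\<lambda>n. a n * b n) f"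
  then obtain a b where ab: "generates a d" "generates b e" "generates (\<lambda>n. a n * b n) f" by blast
  then have "(\<lambda>n. real_of_rat (a n) * real_of_rat (b n)) \<longlonglongrightarrow> rval d * rval e"
    by (auto simp: generates_iff intro: tendsto_mult)
  moreover have "(\<lambda>n. real_of_rat (a n) * real_of_rat (b n)) \<longlonglongrightarrow> rval f"
    using ab by (auto simp: generates_iff of_rat_mult)
  ultimately have "rval f = rval d * rval e" by (rule LIMSEQ_unique[symmetric])
  then have "rval f = rval (dec_of_real (rval d * rval e))" by simp
  then show "f = dec_of_real (rval d * rval e)" by (simp only: rval_inject)
qed

lemma rval_mult [simp]: "rval (dec_mult d e) = rval d * rval e"
  by (simp add: dec_mult_eq)

lemma rval_of_nat [simp]: "rval (dec_of_nat a) = real a"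
proof -
  have fin: "of_nat a \<in> finite_decimals"
  proof -
    have "(of_nat a :: rat) = of_int (int a) / 10 ^ 0" by simp
    then show ?thesis unfolding finite_decimals_def by blast
  qed
  have "dec_of_nat a = dec_of_real (real a)"
    unfolding dec_of_nat_def
  proof (rule the_equality)
    fix d assume "generates (\<lambda>n. of_nat a) d"
    then have "rval d = rval (dec_of_real (real a))"
      by (simp add: generates_iff LIMSEQ_const_iff)
    then show "d = dec_of_real (real a)" by (simp only: rval_inject)
  qed (use fin in \<open>simp add: generates_iff\<close>)
  then show ?thesis by simp
qed

lemma rval_one: "rval dec_one = 1"
proof -
  have "\<exists>m\<le>n. (if m = 0 then 1 else 0) \<noteq> (9::nat)" for n :: int
    by (intro exI[of _ "min n (-1)"]) auto
  then have "Rep_decimal dec_one = (False, 0, \<lambda>n. if n = 0 then 1 else 0)"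
    unfolding dec_one_def by (intro Abs_decimal_inverse) (auto simp: is_decimal_def)
  then have d: "has_minus dec_one = False" "dec_order dec_one = 0"
      "digit dec_one = (\<lambda>n. if n = 0 then 1 else 0)"
    by (simp_all add: has_minus_def dec_order_def digit_def)
  have pre1: "leading dec_one (Suc i) = 10 ^ i" for i
    by (induction i) (simp_all add: d)
  have "int (leading dec_one i) = \<lfloor>1 * 10 ^ i / 10 ^ (dec_order dec_one + 1) :: real\<rfloor>" for i
  proof (cases i)
    case (Suc j)
    have "(1 * 10 ^ Suc j / 10 ^ (dec_order dec_one + 1) :: real) = real_of_int (10 ^ j)" by (simp add: d)
    then show ?thesis unfolding Suc pre1 by (simp only: floor_of_int) simp
  qed (simp add: d)
  then have "mag dec_one = 1" by (rule mag_eqI)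
  then show ?thesis by (simp add: rval_def d)
qed

lemma rval_inverse: "rval e \<noteq> 0 \<Longrightarrow> rval (dec_inverse e) = 1 / rval e"
proof -
  assume e: "rval e \<noteq> 0"
  have "dec_inverse e = dec_of_real (1 / rval e)"
    unfolding dec_inverse_def
  proof (rule the_equality)
    show "dec_mult e (dec_of_real (1 / rval e)) = dec_one"
      using e by (simp add: rval_one flip: rval_inject)
    fix f assume "dec_mult e f = dec_one"
    then have "rval e * rval f = 1" by (simp add: rval_one flip: rval_inject)
    then show "f = dec_of_real (1 / rval e)" using e by (simp add: field_simps flip: rval_inject)
  qed
  then show ?thesis by simp
qed

lemma rval_frac: "b \<ge> 1 \<Longrightarrow> rval (dec_frac a b) = real a / real b"
  by (simp add: dec_frac_def rval_inverse)

section \<open>Two-way transducers as unary machines\<close>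

instance symbol :: countable by countable_datatype

text \<open>The control of a machine that runs a transducer on the first tape. After \<open>Run\<close> has produced a symbol,
\<open>Decr\<close> subtracts one from the counter on the second tape, carrying the symbol along. If the
counter was positive, \<open>Rewind\<close> returns to cell \<open>0\<close> and the transducer goes on; otherwise \<open>Clear\<close>
erases the second tape and \<open>Print\<close> writes the symbol.\<close>

datatype 'q counter_state = Run 'q | Decr 'q symbol | Rewind 'q | Clear symbol | Print symbol | Halt

instance counter_state :: (countable) countable by countable_datatype

text \<open>The result consists of the next state, an optional output symbol and the move of the head.\<close>

type_synonym 'q transducer = "'q \<Rightarrow> symbol \<Rightarrow> 'q \<times> symbol option \<times> int"

fun counter_table ::
  "'q transducer \<Rightarrow> 'q counter_state \<Rightarrow> symbol \<Rightarrow> symbol \<Rightarrow> 'q counter_state \<times> symbol \<times> int \<times> int" where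
  "counter_table \<delta> (Run q) s t =
     (case \<delta> q s of (q', out, mv) \<Rightarrow>
        ((case out of None \<Rightarrow> Run q' | Some c \<Rightarrow> Decr q' c), t, mv, 0))"
| "counter_table \<delta> (Decr q c) s t =
     (if t = Dig 0 then (Decr q c, Dig 1, 0, 1)
      else if t = Blank then (Clear c, Blank, 0, -1)
      else (Rewind q, Dig 0, 0, -1))"
| "counter_table \<delta> (Rewind q) s t =
     (if t = Blank then (Run q, Blank, 0, 1) else (Rewind q, t, 0, -1))"
| "counter_table \<delta> (Clear c) s t =
     (if t = Blank then (Print c, Blank, 0, 1) else (Clear c, Blank, 0, -1))"
| "counter_table \<delta> (Print c) s t = (Halt, c, 0, 0)"
| "counter_table \<delta> Halt s t = (Halt, t, 0, 0)"

text \<open>Machine states have to be natural numbers, hence the countable state type and its standard injection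
into them.\<close>

definition counter_machine ::
  "symbol set \<Rightarrow> 'q::countable set \<Rightarrow> 'q \<Rightarrow> 'q transducer \<Rightarrow> machine" where
  "counter_machine A Q q0 \<delta> =
     \<lparr>m_states = to_nat ` (Run ` Q \<union> (\<lambda>(q, c). Decr q c) ` (Q \<times> A) \<union> Rewind ` Q \<union> Clear ` A \<union> Print ` A \<union> {Halt}),
      m_init = to_nat (Run q0),
      m_term = to_nat (Halt :: 'q counter_state),
      m_alphabet = A \<union> {Dig 0, Dig 1, Blank},
      m_table = (\<lambda>n s t. case counter_table \<delta> (from_nat n) s t of (q, r) \<Rightarrow> (to_nat q, r))\<rparr>"

lemma unary_machine_counter_machine:
  assumes "finite A" "finite Q" "q0 \<in> Q"
    and closed: "\<And>q s. q \<in> Q \<Longrightarrow> s \<in> A \<union> {Dig 0, Dig 1, Blank} \<Longrightarrow>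
      fst (\<delta> q s) \<in> Q \<and> set_option (fst (snd (\<delta> q s))) \<subseteq> A \<and> snd (snd (\<delta> q s)) \<in> {-1, 0, 1}"
  shows "unary_machine A (counter_machine A Q q0 \<delta>)"
  unfolding unary_machine_def
proof (intro conjI ballI)
  define S where "S = Run ` Q \<union> (\<lambda>(q, c). Decr q c) ` (Q \<times> A) \<union> Rewind ` Q \<union> Clear ` A \<union> Print ` A \<union> {Halt}"
  have states: "m_states (counter_machine A Q q0 \<delta>) = to_nat ` S"
    by (simp add: counter_machine_def S_def)
  fix n s t
  assume "n \<in> m_states (counter_machine A Q q0 \<delta>)"
    and s: "s \<in> m_alphabet (counter_machine A Q q0 \<delta>)" and t: "t \<in> m_alphabet (counter_machine A Q q0 \<delta>)"
  then obtain q where q: "q \<in> S" "n = to_nat q" by (auto simp: states)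
  have al: "m_alphabet (counter_machine A Q q0 \<delta>) = A \<union> {Dig 0, Dig 1, Blank}"
    by (simp add: counter_machine_def)
  have "counter_table \<delta> q s t \<in> S \<times> (A \<union> {Dig 0, Dig 1, Blank}) \<times> {-1, 0, 1} \<times> {-1, 0, 1}"
  proof (cases q)
    case (Run p)
    then have "p \<in> Q" using q by (auto simp: S_def)
    obtain p' out mv where d: "\<delta> p s = (p', out, mv)" by (metis prod_cases3)
    have "p' \<in> Q" "set_option out \<subseteq> A" "mv \<in> {-1, 0, 1}"
      using closed[OF \<open>p \<in> Q\<close> s[unfolded al]] by (simp_all add: d)
    then show ?thesis using t by (cases out) (auto simp: Run d S_def al)
  qed (use q t in \<open>auto simp: S_def al\<close>)
  then show "m_table (counter_machine A Q q0 \<delta>) n s t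
      \<in> m_states (counter_machine A Q q0 \<delta>) \<times> m_alphabet (counter_machine A Q q0 \<delta>) \<times> {-1, 0, 1} \<times> {-1, 0, 1}"
    unfolding states al by (auto simp: counter_machine_def q)
qed (use assms in \<open>auto simp: counter_machine_def\<close>)

definition list_tape :: "symbol list \<Rightarrow> int \<Rightarrow> symbol" where
  "list_tape ws i = (if 0 \<le> i \<and> i < int (length ws) then ws ! nat i else Blank)"

lemma list_tape_bits: "tape2 m = list_tape (bits m)"
  by (auto simp: tape2_def list_tape_def fun_eq_iff)

lemma list_tape_append_Cons [simp]:
  "list_tape (xs @ a # ys) (int (length xs)) = a"
  "(list_tape (xs @ a # ys))(int (length xs) := b) = list_tape (xs @ b # ys)"
  by (auto simp: list_tape_def fun_eq_iff nth_append nth_Cons split: nat.split)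

lemma list_tape_end [simp]:
  "list_tape xs (int (length xs)) = Blank"
  "list_tape xs (-1) = Blank"
  "list_tape (xs @ [Blank]) = list_tape xs"
  by (auto simp: list_tape_def fun_eq_iff nth_append)

text \<open>The counter keeps its width while it is decremented, so it may acquire leading zeros; its value is
therefore read off a list of bits that need not be of the form \<open>bits m\<close>.\<close>

fun counter_value :: "symbol list \<Rightarrow> nat" where
  "counter_value [] = 0"
| "counter_value (b # bs) = (if b = Dig 1 then 1 else 0) + 2 * counter_value bs"

lemma bits_binary: "set (bits m) \<subseteq> {Dig 0, Dig 1}"
proof (induction m rule: bits.induct)
  case (1 m)
  then show ?case by (cases "m < 2") (auto simp: bits.simps[of m])
qed

lemma counter_value_bits: "counter_value (bits m) = m"
proof (induction m rule: bits.induct)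
  case (1 m)
  show ?case
  proof (cases "m < 2")
    case False
    then show ?thesis using 1 by (simp add: bits.simps[of m]) presburger
  qed (auto simp: bits.simps[of m])
qed

definition reach :: "machine \<Rightarrow> word \<Rightarrow> config \<Rightarrow> config \<Rightarrow> bool" where
  "reach M x c c' \<longleftrightarrow> (\<exists>t. (step M x ^^ t) c = c')"

lemma reach_trans: "reach M x c c' \<Longrightarrow> reach M x c' c'' \<Longrightarrow> reach M x c c''"
  unfolding reach_def by (metis comp_apply funpow_add)

lemma reach_step: "step M x c = c' \<Longrightarrow> reach M x c' c'' \<Longrightarrow> reach M x c c''"
  unfolding reach_def by (metis comp_apply funpow_Suc_right)

lemma reach_refl: "reach M x c c"
  unfolding reach_def by (metis funpow_0)

text \<open>The output belongs to the run and not to the configurations, so that the phases of a computation can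
be studied separately and concatenated (\<open>run_trans\<close>).\<close>

inductive run :: "'q transducer \<Rightarrow> word \<Rightarrow> 'q \<Rightarrow> int \<Rightarrow> symbol list \<Rightarrow> 'q \<Rightarrow> int \<Rightarrow> bool"
  for \<delta> x where
  run_refl: "run \<delta> x q h [] q h"
| run_silent: "\<delta> q (tape1 x h) = (q', None, mv) \<Longrightarrow> run \<delta> x q' (h + mv) ws q'' h'' \<Longrightarrow> run \<delta> x q h ws q'' h''"
| run_emit: "\<delta> q (tape1 x h) = (q', Some c, mv) \<Longrightarrow> run \<delta> x q' (h + mv) ws q'' h'' \<Longrightarrow> run \<delta> x q h (c # ws) q'' h''"

lemma run_trans: "run \<delta> x q h ws q' h' \<Longrightarrow> run \<delta> x q' h' ws' q'' h'' \<Longrightarrow> run \<delta> x q h (ws @ ws') q'' h''"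
  by (induction rule: run.induct) (auto intro: run.intros)

context
  fixes A :: "symbol set" and Q :: "'q::countable set" and q0 :: 'q and \<delta> :: "'q transducer" and x :: word
begin

abbreviation "CM \<equiv> counter_machine A Q q0 \<delta>"

text \<open>The successor is kept as an expression to be computed by simplification, so that a known machine step
is executed by resolving with this rule and simplifying.\<close>

lemma reach_counter_step:
  "q \<noteq> Halt \<Longrightarrow>
   reach CM x (case counter_table \<delta> q (tape1 x h1) (T h2) of (q', s, v1, v2) \<Rightarrow>
     (to_nat q', h1 + v1, h2 + v2, T(h2 := s))) c \<Longrightarrow>
   reach CM x (to_nat q, h1, h2, T) c"
  by (rule reach_step[OF refl]) (simp add: step_def counter_machine_def split: prod.splits)

lemma rewind:
  fixes q :: 'q
  assumes "j < int (length ws)" "-1 \<le> j" "Blank \<notin> set ws"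
  shows "reach CM x (to_nat (Rewind q), h, j, list_tape ws) (to_nat (Run q), h, 0, list_tape ws)"
  using assms(1,2)
proof (induction "nat (j + 1)" arbitrary: j)
  case 0
  then have "j = -1" by simp
  then show ?case
    by - (rule reach_counter_step, simp, simp add: reach_refl fun_upd_idem)
next
  case (Suc i)
  then have "list_tape ws j \<in> set ws" by (auto simp: list_tape_def)
  then have "list_tape ws j \<noteq> Blank" using assms(3) by auto
  moreover have "reach CM x (to_nat (Rewind q), h, j - 1, list_tape ws) (to_nat (Run q), h, 0, list_tape ws)"
    using Suc by auto
  ultimately show ?case
    by - (rule reach_counter_step, simp, simp add: fun_upd_idem)
qed

text \<open>Subtracting one with least significant bit first: zeros turn into ones until the first one is found,
which turns into zero. The list \<open>xs\<close> holds the cells already passed.\<close>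

lemma decrement:
  fixes q :: 'q
  assumes "set bs \<subseteq> {Dig 0, Dig 1}" "counter_value bs > 0" "Blank \<notin> set xs"
  shows "\<exists>bs'. set bs' \<subseteq> {Dig 0, Dig 1} \<and> Suc (counter_value bs') = counter_value bs \<and>
    reach CM x (to_nat (Decr q c), h, int (length xs), list_tape (xs @ bs))
              (to_nat (Run q), h, 0, list_tape (xs @ bs'))"
  using assms
proof (induction bs arbitrary: xs)
  case (Cons b bs)
  show ?case
  proof (cases "b = Dig 1")
    case True
    have "Blank \<notin> set (xs @ Dig 0 # bs)" using Cons.prems by auto
    then have "reach CM x (to_nat (Rewind q), h, int (length xs) - 1, list_tape (xs @ Dig 0 # bs))
        (to_nat (Run q), h, 0, list_tape (xs @ Dig 0 # bs))"
      by (intro rewind) auto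
    then have "reach CM x (to_nat (Decr q c), h, int (length xs), list_tape (xs @ b # bs))
              (to_nat (Run q), h, 0, list_tape (xs @ Dig 0 # bs))"
      by - (rule reach_counter_step, simp, simp add: True)
    then show ?thesis using Cons.prems by (intro exI[of _ "Dig 0 # bs"]) (auto simp: True)
  next
    case False
    then have b: "b = Dig 0" using Cons.prems by auto
    have "set bs \<subseteq> {Dig 0, Dig 1}" "counter_value bs > 0" "Blank \<notin> set (xs @ [Dig 1])"
      using Cons.prems b by auto
    from Cons.IH[OF this] obtain bs' where bs': "set bs' \<subseteq> {Dig 0, Dig 1}" "Suc (counter_value bs') = counter_value bs"
      "reach CM x (to_nat (Decr q c), h, int (length (xs @ [Dig 1])), list_tape ((xs @ [Dig 1]) @ bs))
              (to_nat (Run q), h, 0, list_tape ((xs @ [Dig 1]) @ bs'))"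
      by blast
    from bs'(3) have "reach CM x (to_nat (Decr q c), h, int (length xs), list_tape (xs @ b # bs))
              (to_nat (Run q), h, 0, list_tape (xs @ Dig 1 # bs'))"
      by - (rule reach_counter_step, simp, simp add: b add.commute)
    then show ?thesis using bs' by (intro exI[of _ "Dig 1 # bs'"]) (auto simp: b)
  qed
qed simp

lemma clear_tape:
  assumes "Blank \<notin> set xs"
  shows "reach CM x (to_nat (Clear c :: 'q counter_state), h, int (length xs) - 1, list_tape xs)
    (to_nat (Halt :: 'q counter_state), h, 0, \<lambda>i. if i = 0 then c else Blank)"
  using assms
proof (induction xs rule: rev_induct)
  case Nil
  have "(list_tape [])(0 := c) = (\<lambda>i. if i = 0 then c else Blank)"
    by (auto simp: list_tape_def fun_eq_iff)
  then have "reach CM x (to_nat (Print c :: 'q counter_state), h, 0, list_tape [])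
    (to_nat (Halt :: 'q counter_state), h, 0, \<lambda>i. if i = 0 then c else Blank)"
    by - (rule reach_counter_step, simp, simp add: reach_refl)
  then show ?case
    by - (rule reach_counter_step, simp, simp add: fun_upd_idem)
next
  case (snoc a xs)
  then have "a \<noteq> Blank" "reach CM x (to_nat (Clear c :: 'q counter_state), h, int (length xs) - 1, list_tape xs)
    (to_nat (Halt :: 'q counter_state), h, 0, \<lambda>i. if i = 0 then c else Blank)" by auto
  then show ?case
    by - (rule reach_counter_step, simp, simp)
qed

text \<open>On a counter with value zero, the borrow runs off the end of the number. The zeros have
been overwritten by ones at that point, which is harmless because the tape is erased next.\<close>

lemma decrement_zero:
  fixes q :: 'q
  assumes "set bs \<subseteq> {Dig 0, Dig 1}" "counter_value bs = 0" "Blank \<notin> set xs"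
  shows "reach CM x (to_nat (Decr q c), h, int (length xs), list_tape (xs @ bs))
    (to_nat (Halt :: 'q counter_state), h, 0, \<lambda>i. if i = 0 then c else Blank)"
  using assms
proof (induction bs arbitrary: xs)
  case Nil
  then have "reach CM x (to_nat (Clear c :: 'q counter_state), h, int (length xs) - 1, list_tape xs)
    (to_nat (Halt :: 'q counter_state), h, 0, \<lambda>i. if i = 0 then c else Blank)"
    by (intro clear_tape)
  then show ?case
    by - (rule reach_counter_step, simp, simp add: fun_upd_idem)
next
  case (Cons b bs)
  then have b: "b = Dig 0" by auto
  have "reach CM x (to_nat (Decr q c), h, int (length (xs @ [Dig 1])), list_tape ((xs @ [Dig 1]) @ bs))
    (to_nat (Halt :: 'q counter_state), h, 0, \<lambda>i. if i = 0 then c else Blank)"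
    using Cons.prems by (intro Cons.IH) (auto simp: b)
  then show ?case by - (rule reach_counter_step, simp, simp add: b add.commute)
qed

text \<open>Each produced symbol costs one decrement, so the symbol produced when the counter stands at zero is
the one whose index was the initial counter value.\<close>

lemma run_simulation:
  assumes "run \<delta> x q h ws q' h'" "set bs \<subseteq> {Dig 0, Dig 1}" "counter_value bs < length ws"
  shows "\<exists>h1. reach CM x (to_nat (Run q), h, 0, list_tape bs)
    (to_nat (Halt :: 'q counter_state), h1, 0, \<lambda>i. if i = 0 then ws ! counter_value bs else Blank)"
  using assms
proof (induction arbitrary: bs rule: run.induct)
  case (run_silent q h q' mv ws q'' h'')
  then obtain h1 where "reach CM x (to_nat (Run q'), h + mv, 0, list_tape bs)
    (to_nat (Halt :: 'q counter_state), h1, 0, \<lambda>i. if i = 0 then ws ! counter_value bs else Blank)" by blast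
  then have "reach CM x (to_nat (Run q), h, 0, list_tape bs)
    (to_nat (Halt :: 'q counter_state), h1, 0, \<lambda>i. if i = 0 then ws ! counter_value bs else Blank)"
    by - (rule reach_counter_step, simp, simp add: run_silent.hyps(1) fun_upd_idem)
  then show ?case ..
next
  case (run_emit q h q' c mv ws q'' h'')
  have start: "reach CM x (to_nat (Run q), h, 0, list_tape bs) r"
    if "reach CM x (to_nat (Decr q' c), h + mv, 0, list_tape bs) r" for r
    using that by - (rule reach_counter_step, simp, simp add: run_emit.hyps(1) fun_upd_idem)
  show ?case
  proof (cases "counter_value bs = 0")
    case True
    then have "(c # ws) ! counter_value bs = c" by simp
    then show ?thesis
      using start[OF decrement_zero[OF run_emit.prems(1) True, of "[]" q' c "h + mv", simplified]] by metis
  next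
    case False
    then obtain bs' where bs': "set bs' \<subseteq> {Dig 0, Dig 1}" "Suc (counter_value bs') = counter_value bs"
      "reach CM x (to_nat (Decr q' c), h + mv, 0, list_tape bs) (to_nat (Run q'), h + mv, 0, list_tape bs')"
      using decrement[OF run_emit.prems(1), of "[]" q' c "h + mv"] by auto
    obtain h1 where "reach CM x (to_nat (Run q'), h + mv, 0, list_tape bs')
      (to_nat (Halt :: 'q counter_state), h1, 0, \<lambda>i. if i = 0 then ws ! counter_value bs' else Blank)"
      using run_emit.IH[of bs'] run_emit.prems bs' by auto
    moreover have "(c # ws) ! counter_value bs = ws ! counter_value bs'"
      using bs'(2)[symmetric] by simp
    ultimately show ?thesis
      using start[OF reach_trans[OF bs'(3)]] by metis
  qed
qed simp

end

text \<open>The second tape initially holds \<open>bits m\<close>, which is a counter with value \<open>m\<close>, so the simulation ends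
with the output symbol of index \<open>m\<close>.\<close>

theorem transducer_computable:
  fixes Q :: "'q::countable set"
  assumes "encoding A X" "F ` X \<subseteq> X" "finite Q" "q0 \<in> Q"
    and closed: "\<And>q s. q \<in> Q \<Longrightarrow> s \<in> A \<union> {Dig 0, Dig 1, Blank} \<Longrightarrow>
      fst (\<delta> q s) \<in> Q \<and> set_option (fst (snd (\<delta> q s))) \<subseteq> A \<and> snd (snd (\<delta> q s)) \<in> {-1, 0, 1}"
    and emits: "\<And>x m. x \<in> X \<Longrightarrow> \<exists>ws q h. run \<delta> x q0 0 ws q h \<and> m < length ws \<and> ws ! m = F x m"
  shows "computable A X F"
  unfolding computable_def
proof (intro conjI exI)
  show "unary_machine A (counter_machine A Q q0 \<delta>)"
    using assms by (intro unary_machine_counter_machine) (auto simp: encoding_def)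
  show "computes (counter_machine A Q q0 \<delta>) X F"
    unfolding computes_def
  proof (intro ballI allI)
    fix x m assume "x \<in> X"
    then obtain ws q h where ws: "run \<delta> x q0 0 ws q h" "m < length ws" "ws ! m = F x m"
      using emits by blast
    obtain h1 where "reach (counter_machine A Q q0 \<delta>) x (to_nat (Run q0), 0, 0, list_tape (bits m))
      (to_nat (Halt :: 'q counter_state), h1, 0, \<lambda>i. if i = 0 then F x m else Blank)"
      using run_simulation[OF ws(1) bits_binary, of m A Q q0] ws(2) unfolding counter_value_bits ws(3) by blast
    moreover have "init_config (counter_machine A Q q0 \<delta>) m = (to_nat (Run q0), 0, 0, list_tape (bits m))"
      by (simp add: init_config_def counter_machine_def list_tape_bits)
    moreover have "m_term (counter_machine A Q q0 \<delta>) = to_nat (Halt :: 'q counter_state)"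
      by (simp add: counter_machine_def)
    ultimately show "terminates_with (counter_machine A Q q0 \<delta>) x m (\<lambda>i. if i = 0 then F x m else Blank)"
      unfolding terminates_with_def reach_def by metis
  qed
qed (use assms in auto)

section \<open>Continuity of computable operations\<close>

lemma code_prefix_not_Nil: "code_prefix d \<noteq> []"
  by (simp add: code_prefix_def)

lemma bits_not_Nil: "bits k \<noteq> []"
  by (simp add: bits.simps[of k])

lemma u_prefix: "n < length (code_prefix d) \<Longrightarrow> u d n = code_prefix d ! n"
  by (simp add: u_def)

lemma u_digit: "u d (length (code_prefix d) + i) = Dig (digit d (int (dec_order d) - int i))"
  by (simp add: u_def)

lemma u_Sep_iff: "n < length (code_prefix d) \<Longrightarrow> u d n = Sep \<longleftrightarrow> Suc n = length (code_prefix d)"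
proof -
  assume n: "n < length (code_prefix d)"
  define p where "p = (if has_minus d then [Minus] else []) @ bits (dec_order d)"
  have p: "code_prefix d = p @ [Sep]" "Sep \<notin> set p"
    using bits_binary[of "dec_order d"] by (auto simp: code_prefix_def p_def)
  moreover have "p ! n \<noteq> Sep" if "n < length p" using p(2) nth_mem[OF that] by metis
  ultimately show ?thesis using n by (cases "n = length p") (auto simp: u_prefix nth_append)
qed

lemma u_0_Minus_iff: "u d 0 = Minus \<longleftrightarrow> has_minus d"
proof -
  obtain b bs where b: "bits (dec_order d) = b # bs" using bits_not_Nil by (cases "bits (dec_order d)") auto
  then have "b \<noteq> Minus" using bits_binary[of "dec_order d"] by auto
  then show ?thesis by (auto simp: u_def code_prefix_def b)
qed

text \<open>The separator marks the end of the prefix because it occurs nowhere before (\<open>u_Sep_iff\<close>), so equal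
words have equal prefixes and then equal digits.\<close>

lemma inj_u: "inj u"
proof (rule injI)
  fix d e assume eq: "u d = u e"
  have le: "length (code_prefix d) \<le> length (code_prefix e)" if "u d = u e" for d e
  proof (rule ccontr)
    assume l: "\<not> ?thesis"
    have "0 < length (code_prefix e)" using code_prefix_not_Nil by blast
    then have e: "u e (length (code_prefix e) - 1) = Sep" by (subst u_Sep_iff) auto
    have "u d (length (code_prefix e) - 1) \<noteq> Sep"
      using l \<open>0 < length (code_prefix e)\<close> by (subst u_Sep_iff) auto
    then show False using e that by simp
  qed
  have len: "length (code_prefix d) = length (code_prefix e)" using le[of d e] le[of e d] eq by simp
  then have prefix: "code_prefix d = code_prefix e"
  proof (rule nth_equalityI)
    fix i assume "i < length (code_prefix d)"
    then show "code_prefix d ! i = code_prefix e ! i"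
      using u_prefix[of i d] u_prefix[of i e] len eq by simp
  qed
  have m: "has_minus d = has_minus e" using u_0_Minus_iff[of d] u_0_Minus_iff[of e] eq by simp
  then have "bits (dec_order d) = bits (dec_order e)" using prefix by (simp add: code_prefix_def)
  from arg_cong[OF this, of counter_value] have k: "dec_order d = dec_order e"
    by (simp add: counter_value_bits)
  show "d = e"
  proof (rule decimal_eqI[OF m k])
    fix p show "digit d p = digit e p"
    proof (cases "p \<le> int (dec_order d)")
      case True
      define i where "i = nat (int (dec_order d) - p)"
      have p: "p = int (dec_order d) - int i" using True by (simp add: i_def)
      show ?thesis unfolding p using u_digit[of d i] u_digit[of e i] len k eq by simp
    qed (simp add: digit_above_order k)
  qed
qed

lemma mult_shift_u: "mult_shift d (u x) = u (dec_mult d x)"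
  by (simp add: mult_shift_def the_inv_f_f[OF inj_u])

lemma encoding_X_R: "encoding A_R X_R"
proof -
  have "u d n \<in> A_R" for d n
  proof (cases "n < length (code_prefix d)")
    case True
    then have "u d n \<in> set (code_prefix d)" by (simp add: u_prefix)
    then show ?thesis using bits_binary[of "dec_order d"] by (auto simp: code_prefix_def A_R_def split: if_splits)
  next
    case False
    then show ?thesis using digit_le_9 by (auto simp: u_def A_R_def)
  qed
  moreover have "finite A_R" "A_R \<noteq> {}" "Blank \<notin> A_R" "X_R \<noteq> {}" by (auto simp: A_R_def X_R_def)
  ultimately show ?thesis by (auto simp: encoding_def X_R_def)
qed

lemma mult_shift_closed: "mult_shift d ` X_R \<subseteq> X_R"
  by (auto simp: X_R_def mult_shift_u)

lemma leading_div: "leading d (i + j) div 10 ^ j = leading d i"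
proof (induction j)
  case (Suc j)
  have "leading d (i + Suc j) div 10 = leading d (i + j)" using digit_le_9[of d "int (dec_order d) - int (i + j)"] by simp
  then show ?case using Suc by (simp add: div_mult2_eq del: leading.simps)
qed simp

text \<open>Agreement of the numbers formed by \<open>i\<close> leading digits gives agreement of those digits, as the shorter
leading parts are obtained by integer division.\<close>

lemma u_agree:
  assumes "has_minus d = has_minus e" "dec_order d = dec_order e" "leading d i = leading e i"
    and n: "n < length (code_prefix d) + i"
  shows "u d n = u e n"
proof -
  have len: "code_prefix d = code_prefix e" using assms by (simp add: code_prefix_def)
  show ?thesis
  proof (cases "n < length (code_prefix d)")
    case False
    define j where "j = n - length (code_prefix d)"
    have j: "n = length (code_prefix d) + j" "j < i" using n False by (auto simp: j_def)
    have "leading d l = leading e l" if "l \<le> i" for l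
      using leading_div[of d l "i - l"] leading_div[of e l "i - l"] that assms(3) by simp
    from this[of j] this[of "Suc j"] have "digit d (int (dec_order d) - int j) = digit e (int (dec_order e) - int j)"
      using j(2) by simp
    then show ?thesis using u_digit[of d j] u_digit[of e j] len j by simp
  qed (simp add: u_prefix len)
qed

lemma funpow_step_cong:
  "\<exists>N. \<forall>x'. (\<forall>n<N. x' n = x n) \<longrightarrow> (step M x' ^^ t) c = (step M x ^^ t) c"
proof (induction t)
  case (Suc t)
  then obtain N where N: "\<And>x'. (\<forall>n<N. x' n = x n) \<Longrightarrow> (step M x' ^^ t) c = (step M x ^^ t) c" by blast
  obtain q h1 h2 T where c: "(step M x ^^ t) c = (q, h1, h2, T)" by (metis prod_cases4)
  show ?case
  proof (intro exI[of _ "max N (nat h1 + 1)"] allI impI)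
    fix x' :: word assume x': "\<forall>n<max N (nat h1 + 1). x' n = x n"
    then have t: "tape1 x' h1 = tape1 x h1" by (simp add: tape1_def)
    have c': "(step M x' ^^ t) c = (q, h1, h2, T)" using N[of x'] x' c by simp
    show "(step M x' ^^ Suc t) c = (step M x ^^ Suc t) c"
      by (simp only: funpow.simps comp_apply c c') (simp add: step_def t)
  qed
qed auto

lemma terminates_with_unique:
  assumes "terminates_with M x m T" "terminates_with M x m T'"
  shows "T = T'"
proof -
  have stay: "(step M x ^^ t) (m_term M, h1, h2, T) = (m_term M, h1, h2, T)" for t h1 h2 T
    by (induction t) (auto simp: step_def)
  obtain t h1 h2 t' h1' h2' where
    t: "(step M x ^^ t) (init_config M m) = (m_term M, h1, h2, T)"
    and t': "(step M x ^^ t') (init_config M m) = (m_term M, h1', h2', T')"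
    using assms by (auto simp: terminates_with_def)
  have "(step M x ^^ (t' + t)) (init_config M m) = (m_term M, h1, h2, T)"
    unfolding funpow_add by (simp add: t stay)
  moreover have "(step M x ^^ (t + t')) (init_config M m) = (m_term M, h1', h2', T')"
    unfolding funpow_add by (simp add: t' stay)
  ultimately show ?thesis by (simp add: add.commute)
qed

text \<open>A terminating run scans finitely many cells of the first tape, and the same run takes place on every
word that agrees there.\<close>

lemma computes_continuous:
  assumes M: "computes M X F" and x: "x \<in> X"
  shows "\<exists>N. \<forall>x'\<in>X. (\<forall>n<N. x' n = x n) \<longrightarrow> F x' m = F x m"
proof -
  have "terminates_with M x m (\<lambda>i. if i = 0 then F x m else Blank)"
    using M x by (simp add: computes_def)
  then obtain t h1 h2 where t: "(step M x ^^ t) (init_config M m) = (m_term M, h1, h2, (\<lambda>i. if i = 0 then F x m else Blank))"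
    unfolding terminates_with_def by blast
  obtain N where N: "\<forall>x'. (\<forall>n<N. x' n = x n) \<longrightarrow> (step M x' ^^ t) (init_config M m) = (step M x ^^ t) (init_config M m)"
    using funpow_step_cong[where x = x and M = M and t = t and c = "init_config M m"] by blast
  have "F x' m = F x m" if x': "x' \<in> X" "\<forall>n<N. x' n = x n" for x'
  proof -
    have "terminates_with M x' m (\<lambda>i. if i = 0 then F x m else Blank)"
      using N[rule_format, of x'] x'(2) t unfolding terminates_with_def by metis
    moreover have "terminates_with M x' m (\<lambda>i. if i = 0 then F x' m else Blank)"
      using M x'(1) by (simp add: computes_def)
    ultimately have "(\<lambda>i::int. if i = 0 then F x m else Blank) = (\<lambda>i. if i = 0 then F x' m else Blank)"
      by (rule terminates_with_unique)
    from fun_cong[OF this, of 0] show ?thesis by simp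
  qed
  then show ?thesis by blast
qed

text \<open>Continuity in terms of real numbers: a nonnegative \<open>z\<close> of the same order as \<open>y\<close> whose expansion
agrees with that of \<open>y\<close> in sufficiently many leading digits has a product with \<open>d\<close> that shows the
same symbol at position \<open>m\<close>.\<close>

lemma mult_shift_truncation:
  assumes M: "computes M X_R (mult_shift d)" and "y \<ge> 0"
    and k: "dec_order (dec_of_real y) = k"
  shows "\<exists>N. \<forall>i\<ge>N. \<forall>z\<ge>0. (k = 0 \<or> 10 ^ k \<le> z) \<longrightarrow> z < 10 ^ (k + 1) \<longrightarrow>
     \<lfloor>z * 10 ^ i / 10 ^ (k + 1)\<rfloor> = \<lfloor>y * 10 ^ i / 10 ^ (k + 1)\<rfloor> \<longrightarrow>
     u (dec_of_real (rval d * z)) m = u (dec_of_real (rval d * y)) m"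
proof -
  define x where "x = dec_of_real y"
  have x: "rval x = y" "mag x = y" "\<not> has_minus x"
    using abs_rval[of x] \<open>y \<ge> 0\<close> by (auto simp: x_def has_minus_iff)
  obtain N where N: "\<forall>x'\<in>X_R. (\<forall>n<N. x' n = u x n) \<longrightarrow> mult_shift d x' m = mult_shift d (u x) m"
    using computes_continuous[OF M, of "u x" m] unfolding X_R_def by blast
  have "u (dec_of_real (rval d * z)) m = u (dec_of_real (rval d * y)) m"
    if "N \<le> i" "z \<ge> 0" and o: "k = 0 \<or> 10 ^ k \<le> z" "z < 10 ^ (k + 1)"
      and f: "\<lfloor>z * 10 ^ i / 10 ^ (k + 1)\<rfloor> = \<lfloor>y * 10 ^ i / 10 ^ (k + 1)\<rfloor>" for i z
  proof -
    define x' where "x' = dec_of_real z"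
    have x': "rval x' = z" "mag x' = z" "\<not> has_minus x'"
      using abs_rval[of x'] \<open>z \<ge> 0\<close> by (auto simp: x'_def has_minus_iff)
    have "dec_order x' = k" using o x' by (intro order_eqI) simp_all
    moreover have "dec_order x = k" using k by (simp add: x_def)
    ultimately have k': "dec_order x' = k" "dec_order x = k" .
    have "int (leading x' i) = int (leading x i)" unfolding leading_eq_floor k' x x' by (rule f)
    then have "u x' n = u x n" if "n < N" for n
      using that \<open>N \<le> i\<close> k' x x' by (intro u_agree[of _ _ i]) auto
    then have "mult_shift d (u x') m = mult_shift d (u x) m" using N unfolding X_R_def by blast
    then show ?thesis by (simp add: mult_shift_u dec_mult_eq x x')
  qed
  then show ?thesis by blast
qed

text \<open>For negative \<open>d\<close>, the first symbol of the result jumps at \<open>0\<close>: it is the minus sign for every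
positive input, however small, but not for \<open>0\<close>.\<close>

lemma nonneg_if_computes:
  assumes M: "computes M X_R (mult_shift d)"
  shows "0 \<le> rval d"
proof (rule ccontr)
  assume neg: "\<not> 0 \<le> rval d"
  have o: "dec_order (dec_of_real 0) = 0"
    using abs_rval[of "dec_of_real 0"] by (intro order_eqI) auto
  obtain N where N: "\<forall>i\<ge>N. \<forall>z\<ge>0. (0 = (0::nat) \<or> 10 ^ 0 \<le> z) \<longrightarrow> z < 10 ^ (0 + 1) \<longrightarrow>
     \<lfloor>z * 10 ^ i / 10 ^ (0 + 1)\<rfloor> = \<lfloor>0 * 10 ^ i / 10 ^ (0 + 1) :: real\<rfloor> \<longrightarrow>
     u (dec_of_real (rval d * z)) 0 = u (dec_of_real (rval d * 0)) 0"
    using mult_shift_truncation[OF M order_refl o, of 0] by blast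
  define z :: real where "z = (1/10) ^ N"
  have z: "0 < z" "z \<le> 1" "z * 10 ^ N / 10 = 1 / 10" by (auto simp: z_def power_le_one power_one_over)
  then have "\<lfloor>z * 10 ^ N / 10\<rfloor> = 0" by simp
  then have "u (dec_of_real (rval d * z)) 0 = u (dec_of_real 0) 0"
    using N[rule_format, of N z] z by simp
  then have "has_minus (dec_of_real (rval d * z)) = has_minus (dec_of_real 0)"
    using u_0_Minus_iff by metis
  then show False using neg z by (simp add: has_minus_iff mult_neg_pos)
qed

text \<open>If \<open>1 / d\<close> has an infinite expansion, every truncation of it is strictly smaller, so its product with
\<open>d\<close> lies in \<open>[0, 1)\<close>, whereas \<open>d \<cdot> (1 / d) = 1\<close>. Both results have order \<open>0\<close>, so that position \<open>2\<close>,
behind the order and the separator, holds the unit digit, and there they differ.\<close>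

lemma finite_decimal_if_computes:
  assumes M: "computes M X_R (mult_shift d)" and pos: "0 < rval d"
  shows "\<exists>N j::nat. 1 / rval d = real N / 10 ^ j"
proof (rule ccontr)
  assume nofin: "\<not> ?thesis"
  define y where "y = 1 / rval d"
  have "y > 0" using pos by (simp add: y_def)
  define x where "x = dec_of_real y"
  have x: "rval x = y" "mag x = y"
    using abs_rval[of x] \<open>y > 0\<close> by (auto simp: x_def)
  define k where "k = dec_order x + 1"
  have k0: "dec_order (dec_of_real y) = dec_order x" by (simp add: x_def)
  obtain N where N: "\<forall>i\<ge>N. \<forall>z\<ge>0. (dec_order x = 0 \<or> 10 ^ dec_order x \<le> z) \<longrightarrow> z < 10 ^ k \<longrightarrow>
     \<lfloor>z * 10 ^ i / 10 ^ k\<rfloor> = \<lfloor>y * 10 ^ i / 10 ^ k\<rfloor> \<longrightarrow>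
     u (dec_of_real (rval d * z)) 2 = u (dec_of_real (rval d * y)) 2"
    using mult_shift_truncation[OF M less_imp_le[OF \<open>y > 0\<close>] k0, of 2] unfolding k_def by blast
  \<comment> \<open>At least one digit is kept, so that the truncation has the same order.\<close>
  define i where "i = Suc N"
  define z where "z = real (leading x i) * 10 ^ k / 10 ^ i"
  have fl: "\<lfloor>z * 10 ^ i / 10 ^ k\<rfloor> = \<lfloor>y * 10 ^ i / 10 ^ k\<rfloor>"
    using leading_eq_floor[of x i] by (simp add: z_def x k_def del: leading.simps)
  have "z \<le> y" using leading_bounds(1)[of x i] by (simp add: z_def x k_def field_simps del: leading.simps)
  moreover have "z \<noteq> y"
  proof
    assume "z = y"
    then have "1 / rval d = real (leading x i * 10 ^ k) / 10 ^ i" by (simp add: z_def y_def del: leading.simps)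
    then show False using nofin by blast
  qed
  ultimately have "z < y" by simp
  have "z < 10 ^ k" using \<open>z < y\<close> mag_less[of x] by (simp add: x k_def)
  have "dec_order x = 0 \<or> 10 ^ dec_order x \<le> z"
  proof (cases "dec_order x = 0")
    case False
    then have "digit x (int (dec_order x)) \<noteq> 0" using leading_digit[of x] by argo
    then have "0 < leading x 1" by simp
    then have "leading x i div 10 ^ N \<noteq> 0" using leading_div[of x 1 N] by (simp add: i_def del: leading.simps)
    then have "10 ^ N \<le> leading x i" by (meson div_less linorder_not_le)
    then have "real (10 ^ N) \<le> real (leading x i)" by (simp only: of_nat_le_iff)
    then have "10 ^ N \<le> real (leading x i)" by simp
    then have "10 ^ N * 10 ^ k / 10 ^ i \<le> z" unfolding z_def by (intro divide_right_mono mult_right_mono) auto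
    then show ?thesis by (simp add: i_def k_def)
  qed simp
  moreover have "z \<ge> 0" by (simp add: z_def)
  ultimately have "u (dec_of_real (rval d * z)) 2 = u (dec_of_real (rval d * y)) 2"
    using N[rule_format, of i z] fl \<open>z < 10 ^ k\<close> by (simp add: i_def)
  moreover have "u (dec_of_real v) 2 = Dig (nat \<lfloor>v\<rfloor>)" if "0 \<le> v" "v \<le> 1" for v
  proof -
    have m: "mag (dec_of_real v) = v" using abs_rval[of "dec_of_real v"] that by simp
    then have o: "dec_order (dec_of_real v) = 0" using that by (intro order_eqI) auto
    have "\<not> has_minus (dec_of_real v)" using that by (simp add: has_minus_iff)
    then have l: "length (code_prefix (dec_of_real v)) = 2" by (simp add: code_prefix_def o bits.simps[of 0])
    have "\<lfloor>v\<rfloor> \<le> 1" using that by linarith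
    then have "nat \<lfloor>v\<rfloor> < 10" by linarith
    then have "nat \<lfloor>v\<rfloor> mod 10 = nat \<lfloor>v\<rfloor>" by (rule mod_less)
    then show ?thesis using u_digit[of "dec_of_real v" 0] by (simp add: l o digit_eq_floor m)
  qed
  moreover have "rval d * y = 1" "0 \<le> rval d * z" "rval d * z < 1"
    using pos \<open>z < y\<close> \<open>z \<ge> 0\<close> by (auto simp: y_def field_simps)
  moreover have "\<lfloor>rval d * z\<rfloor> = 0" using calculation by linarith
  ultimately show False by simp
qed

lemma fraction_if_computes:
  assumes M: "computes M X_R (mult_shift d)"
  shows "\<exists>a b :: nat. b \<ge> 1 \<and> d = dec_frac a b \<and> coprime a b \<and>
       (a \<noteq> 0 \<longrightarrow> (\<forall>p :: nat. prime p \<and> p \<noteq> 2 \<and> p \<noteq> 5 \<longrightarrow> \<not> p dvd a))"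
proof (cases "rval d = 0")
  case True
  then have "d = dec_frac 0 1" by (simp add: rval_frac flip: rval_inject)
  then show ?thesis by (intro exI[of _ 0] exI[of _ 1]) auto
next
  case False
  then have pos: "0 < rval d" using nonneg_if_computes[OF M] by simp
  obtain N j :: nat where N: "1 / rval d = real N / 10 ^ j"
    using finite_decimal_if_computes[OF M pos] by blast
  have "N > 0" using N pos by (cases "N = 0") auto
  define g where "g = gcd (10 ^ j) N"
  define a b where "a = 10 ^ j div g" and "b = N div g"
  have g: "10 ^ j = a * g" "N = b * g" by (simp_all add: a_def b_def g_def)
  have "g > 0" using \<open>N > 0\<close> by (simp add: g_def)
  have cop: "coprime a b" using \<open>N > 0\<close> unfolding a_def b_def g_def by (intro div_gcd_coprime) auto
  have "b \<ge> 1" using g \<open>N > 0\<close> by (cases b) auto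
  have "rval d = 10 ^ j / real N" using N pos \<open>N > 0\<close> by (simp add: field_simps)
  also have "(10::real) ^ j = real (10 ^ j)" by simp
  also have "real (10 ^ j) / real N = real a / real b" unfolding g using \<open>g > 0\<close> by simp
  finally have "d = dec_frac a b" using \<open>b \<ge> 1\<close> by (simp add: rval_frac flip: rval_inject)
  moreover have "\<not> p dvd a" if "prime p" "p \<noteq> 2" "p \<noteq> 5" for p :: nat
  proof
    assume "p dvd a"
    then have "p dvd 10 ^ j" unfolding g by simp
    then have "p dvd 10" by (rule prime_dvd_power[OF \<open>prime p\<close>])
    then have "p dvd 2 * 5" by simp
    then have "p dvd 2 \<or> p dvd 5" by (simp only: prime_dvd_mult_iff[OF \<open>prime p\<close>])
    moreover have "prime (2::nat)" "prime (5::nat)" by simp_all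
    ultimately show False using that primes_dvd_imp_eq by blast
  qed
  ultimately show ?thesis using cop \<open>b \<ge> 1\<close> by blast
qed

section \<open>Multiplication by a power of ten over an integer\<close>

text \<open>The states of the transducer that multiplies by \<open>10 ^ n / B\<close>:
\<^item> \<open>Order a p\<close> reads the binary order \<open>k\<close>; \<open>a\<close> is the value of the bits read so far and \<open>p\<close> the weight
  of the next bit, both capped at \<open>B\<close>.
\<^item> \<open>Count c i r\<close> has read \<open>i\<close> digits, which form the number \<open>r < B\<close>; at most \<open>c = min B k + n\<close> digits
  may be skipped.
\<^item> \<open>Back i\<close> returns to the start of the word with the number \<open>i\<close> of digits to skip.
\<^item> \<open>Copy i w l\<close> copies the sign and adds \<open>n - i\<close> to the order. The integer \<open>w\<close> is the sum of the
  carry, initially \<open>n - i\<close>, and the last \<open>l\<close> bits read, whose sum bits have not been written yet.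
\<^item> \<open>Tail i v\<close> writes the bits of \<open>v\<close>, the remaining high part of the new order.
\<^item> \<open>Mark i\<close> writes the separator.
\<^item> \<open>Divide j r\<close> performs long division with remainder \<open>r\<close>; the next \<open>j\<close> quotient digits are
  suppressed.\<close>

datatype div_state =
    Order nat nat
  | Count nat nat nat
  | Back nat
  | Copy nat int nat
  | Tail nat nat
  | Mark nat
  | Divide nat nat

instance div_state :: countable by countable_datatype

text \<open>Delaying the bits of the order by a window of \<open>V + 1\<close> bits is necessary because the order may get
shorter when \<open>n - i\<close> is negative: a sum bit may be written only once it is certain that it is not one
of the superfluous zeros at the top. With a full window and a bit still to come, the
remaining sum is at least \<open>2 ^ (V + 1)\<close> minus a bounded number, so that it has a further bit.\<close>

fun divider :: "nat \<Rightarrow> nat \<Rightarrow> nat \<Rightarrow> div_state transducer" where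
  "divider B n V (Order a p) s =
     (case s of
        Dig b \<Rightarrow> (Order (min B (a + b * p)) (min B (2 * p)), None, 1)
      | Sep \<Rightarrow> (Count (a + n) 0 0, None, 1)
      | _ \<Rightarrow> (Order a p, None, 1))"
| "divider B n V (Count c i r) s =
     (case s of
        Dig b \<Rightarrow> if i < c \<and> 10 * r + b < B then (Count c (Suc i) (10 * r + b), None, 1) else (Back i, None, -1)
      | _ \<Rightarrow> (Back i, None, -1))"
| "divider B n V (Back i) s =
     (if s = Blank then (Copy i (int n - int i) 0, None, 1) else (Back i, None, -1))"
| "divider B n V (Copy i w l) s =
     (case s of
        Minus \<Rightarrow> (Copy i w l, Some Minus, 1)
      | Dig b \<Rightarrow>
          if l \<le> V then (Copy i (w + int b * 2 ^ l) (Suc l), None, 1)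
          else (Copy i (w div 2 + int b * 2 ^ V) l, Some (Dig (nat (w mod 2))), 1)
      | _ \<Rightarrow> (Tail i (nat w), None, 0))"
| "divider B n V (Tail i v) s =
     (if v < 2 then (Mark i, Some (Dig v), 0) else (Tail i (v div 2), Some (Dig (v mod 2)), 0))"
| "divider B n V (Mark i) s = (Divide i 0, Some Sep, 1)"
| "divider B n V (Divide j r) s =
     (case s of
        Dig b \<Rightarrow> (Divide (j - 1) ((10 * r + b) mod B),
                  if j = 0 then Some (Dig ((10 * r + b) div B)) else None, 1)
      | _ \<Rightarrow> (Divide j r, None, 1))"

text \<open>An invariant that leaves finitely many states. The bound on \<open>w\<close> has the factor \<open>9\<close> because it must
survive any digit symbol in place of a bit.\<close>

fun div_state_bound :: "nat \<Rightarrow> nat \<Rightarrow> nat \<Rightarrow> div_state \<Rightarrow> bool" where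
  "div_state_bound B n V (Order a p) \<longleftrightarrow> a \<le> B \<and> p \<le> B"
| "div_state_bound B n V (Count c i r) \<longleftrightarrow> i \<le> c \<and> c \<le> B + n \<and> r < B"
| "div_state_bound B n V (Back i) \<longleftrightarrow> i \<le> B + n"
| "div_state_bound B n V (Copy i w l) \<longleftrightarrow>
     i \<le> B + n \<and> l \<le> Suc V \<and> - int (B + n) \<le> w \<and> w \<le> int (B + n) + 9 * 2 ^ l"
| "div_state_bound B n V (Tail i v) \<longleftrightarrow> i \<le> B + n \<and> v \<le> B + n + 9 * 2 ^ Suc V"
| "div_state_bound B n V (Mark i) \<longleftrightarrow> i \<le> B + n"
| "div_state_bound B n V (Divide j r) \<longleftrightarrow> j \<le> B + n \<and> r < B"

lemma finite_div_states: "finite {q. div_state_bound B n V q}"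
proof (rule finite_subset)
  define K where "K = B + n"
  define C where "C = K + 9 * 2 ^ Suc V"
  show "{q. div_state_bound B n V q} \<subseteq>
    (\<lambda>(a, p). Order a p) ` ({..B} \<times> {..B}) \<union>
    (\<lambda>(c, i, r). Count c i r) ` ({..K} \<times> {..K} \<times> {..B}) \<union> Back ` {..K} \<union>
    (\<lambda>(i, w, l). Copy i w l) ` ({..K} \<times> {- int K..int C} \<times> {..Suc V}) \<union>
    (\<lambda>(i, v). Tail i v) ` ({..K} \<times> {..C}) \<union> Mark ` {..K} \<union>
    (\<lambda>(j, r). Divide j r) ` ({..K} \<times> {..B})" (is "_ \<subseteq> ?R")
  proof
    fix q assume "q \<in> {q. div_state_bound B n V q}"
    then have q: "div_state_bound B n V q" by simp
    show "q \<in> ?R"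
    proof (cases q)
      case (Copy i w l)
      then have "(2::int) ^ l \<le> 2 ^ Suc V" using q by (intro power_increasing) auto
      then have "w \<le> int C" using q Copy by (simp add: C_def K_def)
      then show ?thesis using q Copy by (auto simp: K_def image_iff)
    qed (use q in \<open>auto simp: K_def C_def image_iff\<close>)
  qed
qed auto

lemma divider_closed:
  assumes "B \<ge> 1" "div_state_bound B n V q" "s \<in> A_R \<union> {Dig 0, Dig 1, Blank}"
  shows "div_state_bound B n V (fst (divider B n V q s)) \<and>
    set_option (fst (snd (divider B n V q s))) \<subseteq> A_R \<and> snd (snd (divider B n V q s)) \<in> {-1, 0, 1}"
proof -
  have b9: "b \<le> 9" if "s = Dig b" for b using assms(3) that by (auto simp: A_R_def)
  have bit: "Dig v \<in> A_R" if "v \<le> 9" for v using that by (auto simp: A_R_def)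
  show ?thesis
  proof (cases q)
    case (Copy i w l)
    have w: "- int (B + n) \<le> w" "w \<le> int (B + n) + 9 * 2 ^ l" "l \<le> Suc V" "i \<le> B + n"
      using assms(2) Copy by auto
    have "(2::int) ^ l \<le> 2 ^ Suc V" using w by (intro power_increasing) auto
    then have "w \<le> int (B + n) + 9 * 2 ^ Suc V" using w by linarith
    then have "w \<le> int (B + n + 9 * 2 ^ Suc V)" by simp
    then have "nat w \<le> B + n + 9 * 2 ^ Suc V" by linarith
    show ?thesis
    proof (cases s)
      case (Dig b)
      show ?thesis
      proof (cases "l \<le> V")
        case True
        have "int b * 2 ^ l \<le> 9 * 2 ^ l" using b9[OF Dig] by (intro mult_right_mono) auto
        moreover have "0 \<le> int b * 2 ^ l" by simp
        ultimately have "- int (B + n) \<le> w + int b * 2 ^ l" "w + int b * 2 ^ l \<le> int (B + n) + 9 * 2 ^ Suc l"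
          using w unfolding power_Suc by linarith+
        then show ?thesis using True w by (simp add: Copy Dig)
      next
        case False
        then have l: "l = Suc V" using w by simp
        have "int b * 2 ^ V \<le> 9 * 2 ^ V" using b9[OF Dig] by (intro mult_right_mono) auto
        moreover have "0 \<le> int b * 2 ^ V" by simp
        moreover have "- int (B + n) \<le> w div 2" "w div 2 \<le> int (B + n) + 9 * 2 ^ V"
          using w unfolding l power_Suc by linarith+
        ultimately have "- int (B + n) \<le> w div 2 + int b * 2 ^ V"
            "w div 2 + int b * 2 ^ V \<le> int (B + n) + 9 * 2 ^ Suc V"
          using w unfolding power_Suc by linarith+
        moreover have "nat (w mod 2) \<le> 9" by simp
        ultimately show ?thesis using w bit l by (simp add: Copy Dig)
      qed
    next
      case Minus
      then show ?thesis using w by (simp add: Copy A_R_def)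
    qed (use w \<open>nat w \<le> B + n + 9 * 2 ^ Suc V\<close> in \<open>auto simp: Copy\<close>)
  next
    case (Divide j r)
    have r: "j \<le> B + n" "r < B" using assms(2) Divide by auto
    show ?thesis
    proof (cases s)
      case (Dig b)
      have "10 * r + b < B * 10" using r b9[OF Dig] by linarith
      then have "(10 * r + b) div B < 10" using r by (simp add: less_mult_imp_div_less mult.commute)
      then show ?thesis using r bit by (auto simp: Divide Dig)
    qed (use r in \<open>auto simp: Divide\<close>)
  next
    case (Tail i v)
    have v: "i \<le> B + n" "v \<le> B + n + 9 * 2 ^ Suc V" using assms(2) Tail by auto
    have "v div 2 \<le> v" by simp
    then show ?thesis using v bit by (auto simp: Tail)
  next
    case (Mark i)
    then show ?thesis using assms(1,2) by (auto simp: A_R_def)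
  qed (use assms(1,2) in \<open>auto split: symbol.split\<close>)
qed

text \<open>Like \<open>reach_counter_step\<close>, for executing transducer steps by simplification.\<close>

lemma run_step:
  "(case \<delta> q (tape1 x h) of (p, out, mv) \<Rightarrow>
      (case out of None \<Rightarrow> run \<delta> x p (h + mv) ws q' h'
       | Some c \<Rightarrow> \<exists>vs. ws = c # vs \<and> run \<delta> x p (h + mv) vs q' h')) \<Longrightarrow>
   run \<delta> x q h ws q' h'"
  by (auto split: prod.splits option.splits intro: run_silent run_emit)

fun reads :: "word \<Rightarrow> int \<Rightarrow> symbol list \<Rightarrow> bool" where
  "reads x h [] \<longleftrightarrow> True"
| "reads x h (a # ws) \<longleftrightarrow> tape1 x h = a \<and> reads x (h + 1) ws"

lemma reads_append: "reads x h (vs @ ws) \<longleftrightarrow> reads x h vs \<and> reads x (h + int (length vs)) ws"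
  by (induction vs arbitrary: h) (auto simp: algebra_simps)

lemma readsI: "(\<And>i. i < length ws \<Longrightarrow> x (j + i) = ws ! i) \<Longrightarrow> reads x (int j) ws"
proof (induction ws arbitrary: j)
  case (Cons a ws)
  have "reads x (int (Suc j)) ws"
  proof (rule Cons.IH)
    fix i assume "i < length ws"
    then show "x (Suc j + i) = ws ! i" using Cons.prems[of "Suc i"] by simp
  qed
  moreover have "x j = a" using Cons.prems[of 0] by simp
  ultimately show ?case by (simp add: tape1_def add.commute)
qed simp

lemma reads_code_prefix: "reads (u d) 0 (code_prefix d)"
  using readsI[of "code_prefix d" "u d" 0] u_prefix by simp

lemma tape1_digit:
  "tape1 (u d) (int (length (code_prefix d)) + int i) = Dig (digit d (int (dec_order d) - int i))"
proof -
  have "tape1 (u d) (int (length (code_prefix d) + i)) = u d (length (code_prefix d) + i)"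
    unfolding tape1_def nat_int by simp
  then show ?thesis unfolding u_digit by simp
qed

text \<open>Capping at \<open>B\<close> commutes with the addition of weighted bits, so the state after the separator depends
on \<open>min B k\<close> only.\<close>

lemma read_order:
  "reads x h (bits k @ [Sep]) \<Longrightarrow>
   run (divider B n V) x (Order (min B a) (min B p)) h [] (Count (min B (a + p * k) + n) 0 0) (h + int (length (bits k)) + 1)"
proof (induction k arbitrary: h a p rule: bits.induct)
  case (1 k)
  have cap: "min B (min B a + b * min B p) = min B (a + b * p)" "min B (2 * min B p) = min B (2 * p)"
    if "b < 2" for b
    using that by (cases b) (auto simp: min_def)
  show ?case
  proof (cases "k < 2")
    case True
    then have "tape1 x h = Dig k" "tape1 x (h + 1) = Sep" using 1(2) by (simp_all add: bits.simps[of k])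
    then have "run (divider B n V) x (Order (min B (a + k * p)) (min B (2 * p))) (h + 1) []
        (Count (min B (a + k * p) + n) 0 0) (h + 1 + 1)"
      by - (rule run_step, simp add: run_refl)
    moreover have "bits k = [Dig k]" using True by (simp add: bits.simps[of k])
    ultimately show ?thesis using cap[OF True] \<open>tape1 x h = Dig k\<close>
      by - (rule run_step, simp add: mult.commute)
  next
    case False
    then have bk: "bits k = Dig (k mod 2) # bits (k div 2)" by (simp add: bits.simps[of k])
    then have r: "tape1 x h = Dig (k mod 2)" "reads x (h + 1) (bits (k div 2) @ [Sep])" using 1(2) by simp_all
    have "a + b * p + 2 * p * c = a + p * (2 * c + b)" for b c by (simp add: algebra_simps)
    from this[of "k mod 2" "k div 2"] have val: "a + k mod 2 * p + 2 * p * (k div 2) = a + p * k" by simp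
    have "run (divider B n V) x (Order (min B (a + k mod 2 * p)) (min B (2 * p))) (h + 1) []
        (Count (min B (a + p * k) + n) 0 0) (h + 1 + int (length (bits (k div 2))) + 1)"
      using 1(1)[OF False r(2), of "a + k mod 2 * p" "2 * p"] unfolding val .
    then show ?thesis using r(1) cap[of "k mod 2"]
      by - (rule run_step, simp add: bk add.commute add.left_commute)
  qed
qed

text \<open>The scan stops at the first digit that makes the quotient positive, or after \<open>c\<close> digits.\<close>

lemma count_leading:
  assumes "leading d i < B" "i \<le> c"
  shows "\<exists>s. run (divider B n V) (u d) (Count c i (leading d i)) (int (length (code_prefix d)) + int i) []
      (Back s) (int (length (code_prefix d)) + int s - 1) \<and>
    s \<le> c \<and> leading d s < B \<and> (s = c \<or> B \<le> leading d (Suc s))"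
  using assms
proof (induction "c - i" arbitrary: i)
  case 0
  then have "i = c" by simp
  have "run (divider B n V) (u d) (Count c i (leading d i)) (int (length (code_prefix d)) + int i) []
      (Back i) (int (length (code_prefix d)) + int i - 1)"
    by (rule run_step) (simp add: tape1_digit run_refl \<open>i = c\<close>)
  then show ?case using 0 \<open>i = c\<close> by blast
next
  case (Suc j)
  show ?case
  proof (cases "leading d (Suc i) < B")
    case True
    have "j = c - Suc i" "Suc i \<le> c" using Suc by auto
    from Suc(1)[OF this(1) True this(2)] obtain s where s:
      "run (divider B n V) (u d) (Count c (Suc i) (leading d (Suc i))) (int (length (code_prefix d)) + int (Suc i)) []
        (Back s) (int (length (code_prefix d)) + int s - 1)"
      "s \<le> c" "leading d s < B" "s = c \<or> B \<le> leading d (Suc s)" by blast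
    have "run (divider B n V) (u d) (Count c i (leading d i)) (int (length (code_prefix d)) + int i) []
        (Back s) (int (length (code_prefix d)) + int s - 1)"
      using s(1) True \<open>Suc i \<le> c\<close> by - (rule run_step, simp add: tape1_digit add.assoc add.commute[of 1])
    then show ?thesis using s by blast
  next
    case False
    have "run (divider B n V) (u d) (Count c i (leading d i)) (int (length (code_prefix d)) + int i) []
        (Back i) (int (length (code_prefix d)) + int i - 1)"
      using False by - (rule run_step, simp add: tape1_digit run_refl)
    then show ?thesis using Suc.prems False by (intro exI[of _ i]) auto
  qed
qed

lemma go_back:
  assumes "\<And>j. x j \<noteq> Blank" "-1 \<le> h"
  shows "run (divider B n V) x (Back i) h [] (Copy i (int n - int i) 0) 0"
  using assms(2)
proof (induction "nat (h + 1)" arbitrary: h)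
  case 0
  then have "h = -1" by simp
  then show ?case by - (rule run_step, simp add: tape1_def run_refl)
next
  case (Suc j)
  then have "run (divider B n V) x (Back i) (h - 1) [] (Copy i (int n - int i) 0) 0" by auto
  moreover have "tape1 x h \<noteq> Blank" using assms(1) Suc(2) by (simp add: tape1_def)
  ultimately show ?case by - (rule run_step, simp)
qed

lemma emit_tail: "run (divider B n V) x (Tail i v) h (bits v @ [Sep]) (Divide i 0) (h + 1)"
proof (induction v rule: bits.induct)
  case (1 v)
  show ?case
  proof (cases "v < 2")
    case True
    have "run (divider B n V) x (Mark i) h [Sep] (Divide i 0) (h + 1)"
      by (rule run_step) (simp add: run_refl)
    then show ?thesis using True by - (rule run_step, simp add: bits.simps[of v])
  next
    case False
    have "bits v = Dig (v mod 2) # bits (v div 2)" using False by (simp add: bits.simps[of v])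
    then show ?thesis using False 1[OF False] by - (rule run_step, simp)
  qed
qed

lemma copy_Sep:
  "tape1 x h = Sep \<Longrightarrow> run (divider B n V) x (Copy i w l) h (bits (nat w) @ [Sep]) (Divide i 0) (h + 1)"
  by (rule run_step) (simp add: emit_tail)

lemma bits_step: "2 \<le> z \<Longrightarrow> bits (nat z) = Dig (nat (z mod 2)) # bits (nat (z div 2))"
  by (subst bits.simps) (auto simp: nat_mod_distrib nat_div_distrib)

text \<open>The hypothesis \<open>C + 2 \<le> 2 ^ Suc V\<close> makes the window wide enough for all \<open>w \<ge> - C\<close>. Once a bit is in
the window, the unread bits must form a positive number, which holds because the order is written
without superfluous zeros.\<close>

lemma copy_bits:
  assumes "reads x h (bits k @ [Sep])" "l \<le> Suc V" "- int C \<le> w" "C + 2 \<le> 2 ^ Suc V"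
    "l > 0 \<Longrightarrow> k > 0" "0 \<le> w + 2 ^ l * int k"
  shows "run (divider B n V) x (Copy i w l) h (bits (nat (w + 2 ^ l * int k)) @ [Sep])
    (Divide i 0) (h + int (length (bits k)) + 1)"
  using assms
proof (induction k arbitrary: h w l rule: bits.induct)
  case (1 k)
  have C: "int C + 2 \<le> 2 ^ Suc V"
    using 1(5) by (metis of_nat_add of_nat_le_iff of_nat_numeral of_nat_power)
  \<comment> \<open>With a full window, the lowest pending bit is final and more bits follow it.\<close>
  have full: "bits (nat (w + 2 ^ l * int k)) = Dig (nat (w mod 2)) # bits (nat (w div 2 + 2 ^ V * int k))"
    if l: "l = Suc V"
  proof -
    have "(2::int) ^ l * 1 \<le> 2 ^ l * int k" using 1(6) l by (intro mult_left_mono) auto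
    then have "2 \<le> w + 2 ^ l * int k" using C 1(4) unfolding l by linarith
    moreover have "(w + 2 ^ l * int k) mod 2 = w mod 2" "(w + 2 ^ l * int k) div 2 = w div 2 + 2 ^ V * int k"
      unfolding l by (simp_all add: mult.assoc)
    ultimately show ?thesis by (simp add: bits_step)
  qed
  show ?case
  proof (cases "k < 2")
    case True
    then have bk: "bits k = [Dig k]" by (simp add: bits.simps[of k])
    have t: "tape1 x h = Dig k" "tape1 x (h + 1) = Sep" using 1(2) by (simp_all add: bk)
    show ?thesis
    proof (cases "l \<le> V")
      case True
      have "run (divider B n V) x (Copy i w l) h (bits (nat (w + int k * 2 ^ l)) @ [Sep]) (Divide i 0) (h + 1 + 1)"
        using True t copy_Sep[of x "h + 1"] by - (rule run_step, simp)
      then show ?thesis by (simp add: bk mult.commute)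
    next
      case False
      then have l: "l = Suc V" using 1(3) by simp
      have "run (divider B n V) x (Copy i w l) h (Dig (nat (w mod 2)) # bits (nat (w div 2 + int k * 2 ^ V)) @ [Sep])
          (Divide i 0) (h + 1 + 1)"
        using False t copy_Sep[of x "h + 1"] by - (rule run_step, simp)
      then show ?thesis unfolding full[OF l] by (simp add: bk mult.commute)
    qed
  next
    case False
    then have bk: "bits k = Dig (k mod 2) # bits (k div 2)" by (simp add: bits.simps[of k])
    have t: "tape1 x h = Dig (k mod 2)" "reads x (h + 1) (bits (k div 2) @ [Sep])" using 1(2) by (simp_all add: bk)
    have "k = k mod 2 + 2 * (k div 2)" by simp
    from arg_cong[OF this, of int] have k: "int k = int (k mod 2) + 2 * int (k div 2)"
      by (simp only: of_nat_add of_nat_mult of_nat_numeral)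
    have scale: "2 ^ j * int k = int (k mod 2) * 2 ^ j + 2 ^ Suc j * int (k div 2)" for j
      unfolding k by (simp only: distrib_left mult.commute power_Suc mult.left_commute)
    have pos: "0 < k div 2" using False by linarith
    show ?thesis
    proof (cases "l \<le> V")
      case True
      have val: "w + int (k mod 2) * 2 ^ l + 2 ^ Suc l * int (k div 2) = w + 2 ^ l * int k"
        unfolding scale[of l] by (simp only: add.assoc)
      have "0 \<le> int (k mod 2) * 2 ^ l" by simp
      then have w: "- int C \<le> w + int (k mod 2) * 2 ^ l" using 1(4) by linarith
      have "run (divider B n V) x (Copy i (w + int (k mod 2) * 2 ^ l) (Suc l)) (h + 1) (bits (nat (w + 2 ^ l * int k)) @ [Sep])
          (Divide i 0) (h + 1 + int (length (bits (k div 2))) + 1)"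
        using 1(1)[OF False t(2) _ w 1(5) pos, of "Suc l"] True 1(7) unfolding val by simp
      then show ?thesis using True t(1)
        by - (rule run_step, simp add: bk add.commute add.left_commute)
    next
      case False
      then have l: "l = Suc V" using 1(3) by simp
      have val: "w div 2 + int (k mod 2) * 2 ^ V + 2 ^ Suc V * int (k div 2) = w div 2 + 2 ^ V * int k"
        unfolding scale[of V] by (simp only: add.assoc)
      have "0 \<le> int (k mod 2) * 2 ^ V" by simp
      moreover have "- int C \<le> w div 2" using 1(4) by linarith
      ultimately have w: "- int C \<le> w div 2 + int (k mod 2) * 2 ^ V" by linarith
      have "0 \<le> (w + 2 ^ l * int k) div 2" using 1(7) by simp
      then have nn: "0 \<le> w div 2 + 2 ^ V * int k" unfolding l by (simp add: mult.assoc)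
      have "run (divider B n V) x (Copy i (w div 2 + int (k mod 2) * 2 ^ V) l) (h + 1) (bits (nat (w div 2 + 2 ^ V * int k)) @ [Sep])
          (Divide i 0) (h + 1 + int (length (bits (k div 2))) + 1)"
        using 1(1)[OF \<open>\<not> k < 2\<close> t(2) _ w 1(5) pos, of l] nn unfolding l val by simp
      then show ?thesis unfolding full[OF l] using False t(1)
        by - (rule run_step, simp add: bk add.commute add.left_commute)
    qed
  qed
qed

text \<open>The remainder after \<open>j\<close> digits is \<open>leading d j mod B\<close>, and the quotient digits of the first \<open>s\<close> steps
are suppressed.\<close>

lemma long_division:
  "run (divider B n V) (u d) (Divide s 0) (int (length (code_prefix d)))
    (map (\<lambda>i. Dig ((10 * (leading d i mod B) + digit d (int (dec_order d) - int i)) div B)) [s..<j])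
    (Divide (s - j) (leading d j mod B)) (int (length (code_prefix d)) + int j)"
proof (induction j)
  case (Suc j)
  define v where "v = 10 * (leading d j mod B) + digit d (int (dec_order d) - int j)"
  have "(10 * (a mod B) + g) mod B = (10 * a + g) mod B" for a g
    by (metis mod_add_left_eq mod_mult_right_eq)
  then have "v mod B = leading d (Suc j) mod B" unfolding v_def leading.simps .
  then have "run (divider B n V) (u d) (Divide (s - j) (leading d j mod B)) (int (length (code_prefix d)) + int j)
    (if s \<le> j then [Dig (v div B)] else []) (Divide (s - Suc j) (leading d (Suc j) mod B)) (int (length (code_prefix d)) + int (Suc j))"
    by - (rule run_step, simp add: tape1_digit flip: v_def, simp add: run_refl add.assoc add.commute[of 1])
  from run_trans[OF Suc this] show ?case by (auto simp: v_def)
qed (simp add: run_refl)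

text \<open>All digits come from \<open>\<lfloor>v / B\<rfloor> = \<lfloor>v\<rfloor> div B\<close>: the integer parts of the quotient are determined by the
integer parts of the dividend. The two conditions on \<open>s\<close> say that the first \<open>s\<close> quotient digits
vanish and that the next one is positive or is the unit digit, so the expansion starts exactly there.\<close>

lemma quotient_expansion:
  assumes "B \<ge> 1" and y: "mag y = 10 ^ n * mag x / real B"
    and s: "s \<le> dec_order x + n" "leading x s < B" "s = dec_order x + n \<or> B \<le> leading x (Suc s)"
  shows "dec_order y = dec_order x + n - s"
    and "digit y (int (dec_order y) - int j) =
      (10 * (leading x (s + j) mod B) + digit x (int (dec_order x) - int (s + j))) div B"
proof -
  define k where "k = dec_order x"
  have fl: "\<lfloor>mag y / 10 powi (int (k + n) - int i)\<rfloor> = int (leading x (Suc i) div B)" for i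
  proof -
    have "(10::real) powi (int (k + n) - int i) = 10 ^ (k + n) / 10 ^ i"
      by (subst power_int_diff) (auto simp del: of_nat_add)
    then have "mag y / 10 powi (int (k + n) - int i) = (mag x * 10 ^ Suc i / 10 ^ (k + 1)) / real_of_int (int B)"
      using y \<open>B \<ge> 1\<close> by (simp add: field_simps power_add)
    also have "\<lfloor>\<dots>\<rfloor> = \<lfloor>mag x * 10 ^ Suc i / 10 ^ (k + 1)\<rfloor> div int B"
      by (rule floor_divide_real_eq_div) simp
    also have "\<dots> = int (leading x (Suc i) div B)"
      using leading_eq_floor[of x "Suc i"] by (simp add: k_def zdiv_int)
    finally show ?thesis .
  qed
  show o: "dec_order y = dec_order x + n - s"
  proof (rule order_eqI)
    define K where "K = k + n - s"
    have K: "k + n = K + s" using s by (simp add: K_def k_def)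
    have "mag x * 10 ^ s / 10 ^ (k + 1) < real B"
      using leading_bounds(2)[of x s] s(2) unfolding k_def by linarith
    then have "mag x * 10 ^ s < real B * 10 ^ (k + 1)" by (simp add: field_simps)
    then have "mag y * 10 ^ s < 10 ^ (k + n + 1)"
      using \<open>B \<ge> 1\<close> by (simp add: y field_simps power_add)
    then have "mag y < 10 ^ (K + 1)" unfolding K by (simp add: power_add)
    then show "mag y < 10 ^ (dec_order x + n - s + 1)" by (simp add: K_def k_def)
    have "10 ^ K \<le> mag y" if "B \<le> leading x (Suc s)"
    proof -
      have "real B \<le> mag x * 10 ^ Suc s / 10 ^ (k + 1)"
        using leading_bounds(1)[of x "Suc s"] that unfolding k_def by linarith
      then have "real B * 10 ^ k \<le> mag x * 10 ^ s" by (simp add: field_simps)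
      then have "10 ^ (k + n) \<le> mag y * 10 ^ s"
        using \<open>B \<ge> 1\<close> by (simp add: y field_simps power_add)
      then show ?thesis unfolding K by (simp add: power_add)
    qed
    then show "dec_order x + n - s = 0 \<or> 10 ^ (dec_order x + n - s) \<le> mag y"
      using s(3) by (auto simp: K_def k_def)
  qed
  have p: "int (dec_order y) - int j = int (k + n) - int (s + j)" using s by (simp add: o k_def)
  define i where "i = s + j"
  define r where "r = leading x i mod B"
  define a where "a = digit x (int k - int i)"
  have "10 * r + a < B * 10"
    using \<open>B \<ge> 1\<close> mod_less_divisor[of B "leading x i"] digit_le_9[of x "int k - int i"] unfolding r_def a_def by linarith
  then have small: "(10 * r + a) div B < 10" by (simp add: less_mult_imp_div_less mult.commute)
  have "leading x (Suc i) = 10 * (B * (leading x i div B) + r) + a" by (simp add: a_def r_def k_def)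
  also have "\<dots> = 10 * r + a + B * (10 * (leading x i div B))" by (simp add: algebra_simps)
  finally have "leading x (Suc i) div B = (10 * r + a) div B + 10 * (leading x i div B)"
    using \<open>B \<ge> 1\<close> by simp
  then have "leading x (Suc i) div B mod 10 = (10 * r + a) div B" using small by simp
  then show "digit y (int (dec_order y) - int j) =
      (10 * (leading x (s + j) mod B) + digit x (int (dec_order x) - int (s + j))) div B"
    unfolding p digit_eq_floor[of y] fl by (simp add: i_def r_def a_def k_def)
qed

text \<open>Capping the order at \<open>B\<close> does no harm: if \<open>B < k\<close>, the leading digit is positive, so \<open>B + n\<close> digits
form a number of at least \<open>10 ^ (B + n - 1) \<ge> B\<close>, and the count ends before the limit does.\<close>

lemma skip_bound:
  assumes "B \<ge> 1" "s \<le> min B (dec_order x) + n" "leading x s < B" 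
     "s = min B (dec_order x) + n \<or> B \<le> leading x (Suc s)"
  shows "s = dec_order x + n \<or> B \<le> leading x (Suc s)"
proof (rule ccontr)
  assume not: "\<not> ?thesis"
  then have s: "s = B + n" "B < dec_order x" using assms(4) by auto
  define t where "t = s - 1"
  have t: "s = Suc t" "B \<le> Suc t" using s(1) \<open>B \<ge> 1\<close> by (simp_all add: t_def)
  have "digit x (int (dec_order x)) \<noteq> 0" using leading_digit[of x] s by auto
  then have "0 < leading x 1" by simp
  then have "leading x s div 10 ^ t \<noteq> 0" using leading_div[of x 1 t] by (simp add: t del: leading.simps)
  then have "10 ^ t \<le> leading x s" by (meson div_less linorder_not_le)
  moreover have "t < 10 ^ t" by (rule less_exp[THEN less_le_trans]) (rule power_mono, auto)
  ultimately show False using assms(3) t by linarith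
qed

text \<open>The division is followed for \<open>m + 1\<close> digits beyond the skipped ones, which reaches position \<open>m\<close> of the
output whatever the length of the prefix.\<close>

lemma divider_run:
  assumes "B \<ge> 1" and V: "B + n + 2 \<le> 2 ^ Suc V" and y: "rval y = 10 ^ n / real B * rval x"
  shows "\<exists>ws q h. run (divider B n V) (u x) (Order 0 (min B 1)) 0 ws q h \<and> m < length ws \<and> ws ! m = u y m"
proof -
  define k where "k = dec_order x"
  define sg where "sg = (if has_minus x then [Minus] else [])"
  define P where "P = length (code_prefix x)"
  have cp: "code_prefix x = sg @ bits k @ [Sep]" by (simp add: code_prefix_def sg_def k_def)
  have P: "int P = int (length sg) + int (length (bits k)) + 1" by (simp add: P_def cp)
  have rd: "reads (u x) 0 sg" "reads (u x) (int (length sg)) (bits k @ [Sep])"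
    using reads_code_prefix[of x] unfolding cp reads_append[of _ _ sg] by simp_all
  have "run (divider B n V) (u x) (Order 0 (min B 1)) 0 [] (Order 0 (min B 1)) (int (length sg))"
  proof (cases "has_minus x")
    case True
    then show ?thesis using rd(1) by - (rule run_step, simp add: sg_def run_refl)
  qed (simp add: sg_def run_refl)
  from run_trans[OF this] read_order[OF rd(2), of B n V 0 1]
  have r1: "run (divider B n V) (u x) (Order 0 (min B 1)) 0 [] (Count (min B k + n) 0 0) (int P)"
    by (simp add: P)
  obtain s where s: "run (divider B n V) (u x) (Count (min B k + n) 0 0) (int P) [] (Back s) (int P + int s - 1)"
    "s \<le> min B k + n" "leading x s < B" "s = min B k + n \<or> B \<le> leading x (Suc s)"
    using count_leading[of x 0 B "min B k + n" n V] \<open>B \<ge> 1\<close> by (auto simp: P_def)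
  have s': "s \<le> k + n" "s = k + n \<or> B \<le> leading x (Suc s)"
    using s skip_bound[OF \<open>B \<ge> 1\<close>, of s x n] by (auto simp: k_def)
  have nb: "u x j \<noteq> Blank" for j
    using encoding_X_R unfolding encoding_def X_R_def by (metis rangeI)
  have r2: "run (divider B n V) (u x) (Back s) (int P + int s - 1) [] (Copy s (int n - int s) 0) 0"
    using nb by (intro go_back) auto
  have r3: "run (divider B n V) (u x) (Copy s (int n - int s) 0) 0 sg (Copy s (int n - int s) 0) (int (length sg))"
  proof (cases "has_minus x")
    case True
    then show ?thesis using rd(1) by - (rule run_step, simp add: sg_def run_refl)
  qed (simp add: sg_def run_refl)
  have "- int (B + n) \<le> int n - int s" using s(2) by linarith
  then have "run (divider B n V) (u x) (Copy s (int n - int s) 0) (int (length sg))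
     (bits (nat (int n - int s + 2 ^ 0 * int k)) @ [Sep]) (Divide s 0) (int (length sg) + int (length (bits k)) + 1)"
    using V s' by (intro copy_bits[OF rd(2)]) auto
  moreover have "nat (int n - int s + 2 ^ 0 * int k) = k + n - s" using s' by simp
  ultimately have r4: "run (divider B n V) (u x) (Copy s (int n - int s) 0) (int (length sg)) (bits (k + n - s) @ [Sep]) (Divide s 0) (int P)"
    by (simp add: P)
  have my: "mag y = 10 ^ n * mag x / real B"
    using y by (simp add: abs_mult flip: abs_rval)
  note q = quotient_expansion[OF \<open>B \<ge> 1\<close> my s'(1)[unfolded k_def] s(3) s'(2)[unfolded k_def]]
  have "has_minus y = has_minus x"
    using \<open>B \<ge> 1\<close> by (simp add: has_minus_iff y divide_less_0_iff mult_less_0_iff)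
  then have cy: "code_prefix y = sg @ bits (k + n - s) @ [Sep]"
    by (simp add: code_prefix_def sg_def q k_def)
  define ds where "ds = map (\<lambda>i. Dig ((10 * (leading x i mod B) + digit x (int (dec_order x) - int i)) div B)) [s..<s + Suc m]"
  have ds: "ds ! j = u y (length (code_prefix y) + j)" if "j < Suc m" for j
    using that unfolding u_digit q(2) by (simp add: ds_def del: upt_Suc)
  have "run (divider B n V) (u x) (Order 0 (min B 1)) 0 (code_prefix y @ ds) (Divide (s - (s + Suc m)) (leading x (s + Suc m) mod B)) (int P + int (s + Suc m))"
    using run_trans[OF run_trans[OF run_trans[OF run_trans[OF run_trans[OF r1 s(1)] r2] r3] r4] long_division[of B n V x s "s + Suc m", folded P_def]]
    unfolding ds_def cy by (simp del: upt_Suc)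
  moreover have "m < length (code_prefix y @ ds)" by (simp add: ds_def)
  moreover have "(code_prefix y @ ds) ! m = u y m"
  proof (cases "m < length (code_prefix y)")
    case False
    then have "(code_prefix y @ ds) ! m = ds ! (m - length (code_prefix y))" by (simp add: nth_append)
    also have "\<dots> = u y m" using ds[of "m - length (code_prefix y)"] False by simp
    finally show ?thesis .
  qed (simp add: nth_append u_prefix)
  ultimately show ?thesis by blast
qed

text \<open>Any sufficiently large window serves; \<open>B + n\<close> bounds the number \<open>- (n - s)\<close> that may be subtracted
from the order.\<close>

lemma computable_ten_power_quotient:
  assumes "B \<ge> 1" and d: "rval d = 10 ^ n / real B"
  shows "computable A_R X_R (mult_shift d)"
proof (rule transducer_computable[OF encoding_X_R mult_shift_closed finite_div_states])
  define V where "V = B + n + 2"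
  have "V < 2 ^ V" by (rule less_exp)
  then have V: "B + n + 2 \<le> 2 ^ Suc V" by (simp add: V_def)
  show "Order 0 (min B 1) \<in> {q. div_state_bound B n V q}" by simp
  show "fst (divider B n V q s) \<in> {q. div_state_bound B n V q} \<and>
      set_option (fst (snd (divider B n V q s))) \<subseteq> A_R \<and> snd (snd (divider B n V q s)) \<in> {-1, 0, 1}"
    if "q \<in> {q. div_state_bound B n V q}" "s \<in> A_R \<union> {Dig 0, Dig 1, Blank}" for q s
    using divider_closed[OF \<open>B \<ge> 1\<close>, of n V q s] that by simp
  show "\<exists>ws q h. run (divider B n V) w (Order 0 (min B 1)) 0 ws q h \<and> m < length ws \<and> ws ! m = mult_shift d w m"
    if w_in: "w \<in> X_R" for w m
  proof -
    obtain x where w: "w = u x" using w_in by (auto simp: X_R_def)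
    show ?thesis unfolding w mult_shift_u
      by (rule divider_run[OF \<open>B \<ge> 1\<close> V]) (simp add: d)
  qed
qed

text \<open>The word of \<open>0\<close> is constant: order \<open>0\<close>, the separator, and digits \<open>0\<close>. The case \<open>d = 0\<close> is separate
because it is not of the form \<open>10 ^ n / B\<close>.\<close>

definition zero_table :: "nat transducer" where
  "zero_table q s = (if q = 0 then (1, Some (Dig 0), 0) else if q = 1 then (2, Some Sep, 0) else (2, Some (Dig 0), 0))"

lemma computable_zero:
  assumes "rval d = 0"
  shows "computable A_R X_R (mult_shift d)"
proof (rule transducer_computable[OF encoding_X_R mult_shift_closed])
  show "finite {0, 1, 2::nat}" "0 \<in> {0, 1, 2::nat}" by auto
  show "fst (zero_table q s) \<in> {0, 1, 2} \<and>
      set_option (fst (snd (zero_table q s))) \<subseteq> A_R \<and> snd (snd (zero_table q s)) \<in> {-1, 0, 1}" for q s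
    by (auto simp: A_R_def zero_table_def)
  show "\<exists>ws q h. run zero_table w 0 0 ws q h \<and> m < length ws \<and> ws ! m = mult_shift d w m"
    if w_in: "w \<in> X_R" for w m
  proof -
    obtain x where w: "w = u x" using w_in by (auto simp: X_R_def)
    define z where "z = dec_mult d x"
    have z: "rval z = 0" by (simp add: z_def assms)
    then have mz: "mag z = 0" using abs_rval[of z] by simp
    then have o: "dec_order z = 0" by (intro order_eqI) auto
    have cz: "code_prefix z = [Dig 0, Sep]"
      by (simp add: code_prefix_def o has_minus_iff z bits.simps[of 0])
    have dz: "digit z p = 0" for p by (simp add: digit_eq_floor mz)
    have loop: "run zero_table w 2 0 (replicate j (Dig 0)) 2 0" for j
    proof (induction j)
      case (Suc j)
      have "zero_table 2 (tape1 w 0) = (2, Some (Dig 0), 0)" by (simp add: zero_table_def)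
      then show ?case using run_emit[of zero_table 2 w 0 2 "Dig 0" 0] Suc by simp
    qed (simp add: run_refl)
    have "run zero_table w 0 0 (Dig 0 # Sep # replicate (Suc m) (Dig 0)) 2 0"
      using loop[of "Suc m"]
      by (intro run_emit[of zero_table 0 w 0 1 _ 0] run_emit[of zero_table 1 w _ 2 _ 0])
        (simp_all add: zero_table_def)
    moreover have "(Dig 0 # Sep # replicate (Suc m) (Dig 0)) ! m = u z m"
    proof (cases "m < 2")
      case True
      then have "m = 0 \<or> m = 1" by linarith
      then show ?thesis using u_prefix[of m z] by (auto simp: cz)
    next
      case False
      then obtain j where "m = Suc (Suc j)" by (metis Suc_1 add_2_eq_Suc le_Suc_ex not_less)
      then show ?thesis using u_digit[of z j] by (simp add: cz dz del: replicate_Suc)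
    qed
    moreover have "m < length (Dig 0 # Sep # replicate (Suc m) (Dig 0))" by simp
    ultimately show ?thesis unfolding w mult_shift_u z_def by blast
  qed
qed

lemma dvd_ten_power:
  "a \<noteq> 0 \<Longrightarrow> (\<And>p::nat. prime p \<Longrightarrow> p dvd a \<Longrightarrow> p = 2 \<or> p = 5) \<Longrightarrow> \<exists>n. a dvd 10 ^ n"
proof (induction a rule: less_induct)
  case (less a)
  show ?case
  proof (cases "a = 1")
    case False
    then obtain p where p: "prime p" "p dvd a" using prime_factor_nat by blast
    then obtain b where b: "a = p * b" by auto
    have "p > 1" using p(1) by (rule prime_gt_1_nat)
    then have "b < a" "b \<noteq> 0" using b less.prems(1) by auto
    then obtain n where "b dvd 10 ^ n" using less.IH[of b] less.prems(2) b by (meson dvd_mult)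
    moreover have "p dvd 10" using less.prems(2)[OF p] by auto
    ultimately have "a dvd 10 ^ Suc n" unfolding b power_Suc by (intro mult_dvd_mono)
    then show ?thesis ..
  qed auto
qed

theorem proposition5p3:
  fixes d :: decimal
  shows "computable A_R X_R (mult_shift d) \<longleftrightarrow>
    (\<exists>a b :: nat. b \<ge> 1 \<and> d = dec_frac a b \<and> dec_nonneg d \<and> coprime a b \<and>
       (a \<noteq> 0 \<longrightarrow> (\<forall>p :: nat. prime p \<and> p \<noteq> 2 \<and> p \<noteq> 5 \<longrightarrow> \<not> p dvd a)))"
proof
  assume "computable A_R X_R (mult_shift d)"
  then obtain M where "computes M X_R (mult_shift d)" by (auto simp: computable_def)
  then show "\<exists>a b :: nat. b \<ge> 1 \<and> d = dec_frac a b \<and> dec_nonneg d \<and> coprime a b \<and>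
       (a \<noteq> 0 \<longrightarrow> (\<forall>p :: nat. prime p \<and> p \<noteq> 2 \<and> p \<noteq> 5 \<longrightarrow> \<not> p dvd a))"
    using fraction_if_computes[of M d] nonneg_if_computes[of M d]
    unfolding dec_nonneg_def has_minus_iff not_less by blast
next
  assume "\<exists>a b :: nat. b \<ge> 1 \<and> d = dec_frac a b \<and> dec_nonneg d \<and> coprime a b \<and>
       (a \<noteq> 0 \<longrightarrow> (\<forall>p :: nat. prime p \<and> p \<noteq> 2 \<and> p \<noteq> 5 \<longrightarrow> \<not> p dvd a))"
  then obtain a b :: nat where b: "b \<ge> 1" "d = dec_frac a b"
    and pr: "a \<noteq> 0 \<Longrightarrow> \<forall>p. prime p \<and> p \<noteq> 2 \<and> p \<noteq> 5 \<longrightarrow> \<not> p dvd a" by blast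
  show "computable A_R X_R (mult_shift d)"
  proof (cases "a = 0")
    case True
    then show ?thesis using b by (intro computable_zero) (simp add: rval_frac)
  next
    case False
    then obtain n where "a dvd 10 ^ n" using dvd_ten_power[of a] pr by blast
    then obtain c where c: "10 ^ n = a * c" by (rule dvdE)
    have "c > 0" using c by (cases c) auto
    have "real (10 ^ n) = real a * real c" unfolding c by simp
    then have "rval d = 10 ^ n / real (b * c)"
      using b \<open>c > 0\<close> by (simp add: rval_frac)
    then show ?thesis using b \<open>c > 0\<close> by (intro computable_ten_power_quotient[of "b * c"]) auto
  qed
qed

end
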